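(* Let $n\in\{2,3\}$, let $\Omega\subset\mathbb{R}^n$ and $\Gamma=\partial\Omega$ be as in the context, and let $\mathcal{T}_h$ be a quasi uniform, shape regular mesh on $\Gamma$ of mesh size $h$, with set of nodes $\mathcal{N}$ and node patches $\tau_{\mathbf{y}}$, $\mathbf{y}\in\mathcal{N}$. Let $\Pi:H^{1/2}(\Gamma)\to H^{1/2}(\Gamma)$ be a (possibly oblique) bounded projector. Assume that there exists a set $\Phi^\star=\{\varphi^*_{\mathbf{y}} : \mathbf{y}\in\mathcal{N}\}\subset L^2(\Gamma)$, not necessarily linearly independent, such that for all $\mathbf{y}\in\mathcal{N}$ $$\int_\Gamma \varphi^*_{\mathbf{y}}(s)\,ds=1,\qquad \operatorname{supp}\varphi^*_{\mathbf{y}}\subseteq\tau_{\mathbf{y}},\qquad c_0\,h^{1/2-n/2}\le\|\varphi^*_{\mathbf{y}}\|_{0,\tau_{\mathbf{y}}}\le C_0\,h^{1/2-n/2},$$ with positive constants $c_0,C_0$ independent of $\mathbf{y}$ and $h$, and such that $$\int_\Gamma (v-\Pi(v))\,\varphi^*_{\mathbf{y}}\,ds=0\quad\text{for all }\mathbf{y}\in\mathcal{N}\text{ and all }v\in H^{1/2}(\Gamma).$$ Then there exist positive constants $c,C$, independent of $h$ (depending only on $\Gamma$, on the shape regularity and quasi uniformity constants of the mesh, on $c_0,C_0$, and on an upper bound for the operator norm of $\Pi$), such that for all $v\in H^{1/2}(\Gamma)$ $$c\,\|v\|^2_{1/2,\Gamma}\le\|\Pi(v)\|^2_{1/2,\Gamma}+\sum_{\mathbf{y}\in\mathcal{N}}|v-\Pi(v)|^2_{1/2,\tau_{\mathbf{y}}}\le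 C\,\|v\|^2_{1/2,\Gamma}.$$
   Context: Domain. $\Omega\subset\mathbb{R}^n$ ($n=2,3$) is a bounded, simply connected, possibly curvilinear polygon ($n=2$) or polyhedron ($n=3$) with Lipschitz boundary $\Gamma=\partial\Omega$, such that the geodesic distance on $\Gamma$ is bounded from above by a constant times the Euclidean distance in $\mathbb{R}^n$. Mesh. $\mathcal{T}_h$ is a decomposition, in the usual finite element sense, of $\Gamma$ into (possibly curvilinear) segments ($n=2$) or triangles ($n=3$), of mesh size $h$. It is quasi uniform (the diameters of all elements are comparable to $h$) and shape regular (the ratio of the diameter of an element to that of its largest inscribed ball is bounded), with constants fixed independently of $h$. $\mathcal{N}$ is the set of nodes (vertices) of $\mathcal{T}_h$, and for $\mathbf{y}\in\mathcal{N}$ the patch of elements sharing $\mathbf{y}$ as a vertex is $\tau_{\mathbf{y}}=\bigcup_{T\in\mathcal{T}_h:\ \mathbf{y}\in\partial T}T$. Norms. For $\tau\subseteq\Gamma$, $\|\cdot\|_{0,\tau}$ is the $L^2(\tau)$ norm (with respect to the surface/arclength measure on $\Gamma$), and $$|v|^2_{1/2,\tau}=\int_\tau dt\int_\tau ds\,\frac{|v(t)-v(s)|^2}{|t-s|^n},\qquad \|v\|^2_{1/2,\tau}=\|v\|^2_{0,\tau}+|v|^2_{1/2,\tau}.$$ $H^{1/2}(\tau)$ is the space of $v\in L^2(\tau)$ with $\|v\|_{1/2,\tau}<\infty$. A projector is a linear operator with $\Pi\circ\Pi=\Pi$.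
   Formalization: Shape regularity of curvilinear elements also requires uniformly bi-Lipschitz element charts (automatic for straight elements); with the diameter to inscribed ball ratio alone, thin necks in curvilinear triangles let disjoint elements come arbitrarily close and the lower bound fails. *)

theory Defs
  imports "HOL-Analysis.Analysis"
begin

section \<open>Surface measure\<close>

text \<open>
  The factor is the volume of the Euclidean ball of radius \<open>diameter / 2\<close> in dimension \<open>s\<close>, so that
  the measure is arc length for \<open>s = 1\<close> and surface area for \<open>s = 2\<close>. Boundedness of the covering
  sets is needed because \<^const>\<open>diameter\<close> is unspecified on unbounded sets.
\<close>

definition hausdorff_outer :: "nat \<Rightarrow> 'a::euclidean_space set \<Rightarrow> ennreal" where
  "hausdorff_outer s A =
     (SUP \<delta>\<in>{0<..}.
        INF C\<in>{C :: nat \<Rightarrow> 'a set. (\<forall>i. bounded (C i) \<and> diameter (C i) \<le> \<delta>) \<and> A \<subseteq> (\<Union>i. C i)}.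
          \<Sum>i. if C i = {} then 0
              else ennreal (unit_ball_vol (real s) * (diameter (C i) / 2) ^ s))"

definition hausdorff_measure :: "nat \<Rightarrow> 'a::euclidean_space measure" where
  "hausdorff_measure s = measure_of UNIV (sets borel) (hausdorff_outer s)"

definition surface_measure :: "'a::euclidean_space set \<Rightarrow> 'a measure" where
  "surface_measure \<tau> = restrict_space (hausdorff_measure (DIM('a) - 1)) \<tau>"


section \<open>The domain\<close>

definition curve_length :: "(real \<Rightarrow> 'a::metric_space) \<Rightarrow> ennreal" where
  "curve_length g =
     (SUP ts\<in>{ts. sorted ts \<and> set ts \<subseteq> {0..1}}.
        \<Sum>i<length ts - 1. ennreal (dist (g (ts ! i)) (g (ts ! Suc i))))"

definition geodesic_dist :: "'a::metric_space set \<Rightarrow> 'a \<Rightarrow> 'a \<Rightarrow> ennreal" where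
  "geodesic_dist S x y =
     (INF g\<in>{g. path g \<and> path_image g \<subseteq> S \<and> pathstart g = x \<and> pathfinish g = y}. curve_length g)"

definition geodesic_dist_bounded :: "'a::metric_space set \<Rightarrow> bool" where
  "geodesic_dist_bounded S \<longleftrightarrow>
     (\<exists>K>0. \<forall>x\<in>S. \<forall>y\<in>S. geodesic_dist S x y \<le> ennreal (K * dist x y))"

text \<open>
  Near each boundary point the set is the strict hypograph, in some unit direction \<open>e\<close>, of a Lipschitz
  function of the component orthogonal to \<open>e\<close>; the values of \<open>\<phi>\<close> off that hyperplane are irrelevant.
\<close>

definition lipschitz_boundary :: "'a::euclidean_space set \<Rightarrow> bool" where
  "lipschitz_boundary \<Omega> \<longleftrightarrow>
     (\<forall>x\<in>frontier \<Omega>. \<exists>U e. \<exists>\<phi> :: 'a \<Rightarrow> real. \<exists>L.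
        open U \<and> x \<in> U \<and> norm e = 1 \<and> L-lipschitz_on UNIV \<phi> \<and>
        \<Omega> \<inter> U = {y\<in>U. y \<bullet> e < \<phi> (y - (y \<bullet> e) *\<^sub>R e)})"

text \<open>
  A curved piece of surface is written as the image of a flat piece \<open>P\<close>, lying in a hyperplane, under
  a \<open>C\<^sup>1\<close> diffeomorphism between open sets of the ambient space. Straight pieces have \<open>\<gamma> = id\<close>.
\<close>

definition regular_chart :: "'a::euclidean_space set \<Rightarrow> ('a \<Rightarrow> 'a) \<Rightarrow> bool" where
  "regular_chart P \<gamma> \<longleftrightarrow>
     (\<exists>U. \<exists>D\<gamma> :: 'a \<Rightarrow> 'a \<Rightarrow>\<^sub>L 'a. open U \<and> P \<subseteq> U \<and> inj_on \<gamma> U \<and> continuous_on U D\<gamma> \<and>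
        (\<forall>x\<in>U. (\<gamma> has_derivative blinfun_apply (D\<gamma> x)) (at x) \<and> inj (blinfun_apply (D\<gamma> x))))"

text \<open>
  The boundary is a finite union of curvilinear faces meeting only along their boundaries. The flat
  pieces are convex; a non-convex face is covered by subdividing it. Two faces may share several
  edges or vertices (as the two arcs bounding a planar lens do).
\<close>

definition curvilinear_polytope :: "'a::euclidean_space set \<Rightarrow> bool" where
  "curvilinear_polytope \<Omega> \<longleftrightarrow>
     (\<exists>\<F> :: ('a set \<times> ('a \<Rightarrow> 'a)) set. finite \<F> \<and>
        (\<forall>(P, \<gamma>)\<in>\<F>. polytope P \<and> aff_dim P = int DIM('a) - 1 \<and> regular_chart P \<gamma>) \<and>
        frontier \<Omega> = (\<Union>(P, \<gamma>)\<in>\<F>. \<gamma> ` P) \<and>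
        (\<forall>(P, \<gamma>)\<in>\<F>. \<forall>(Q, \<psi>)\<in>\<F>. (P, \<gamma>) \<noteq> (Q, \<psi>) \<longrightarrow>
           \<gamma> ` P \<inter> \<psi> ` Q \<subseteq> \<gamma> ` rel_frontier P \<inter> \<psi> ` rel_frontier Q))"

definition admissible_domain :: "'a::euclidean_space set \<Rightarrow> bool" where
  "admissible_domain \<Omega> \<longleftrightarrow>
     \<Omega> \<noteq> {} \<and> open \<Omega> \<and> connected \<Omega> \<and> bounded \<Omega> \<and> simply_connected \<Omega> \<and>
     curvilinear_polytope \<Omega> \<and> lipschitz_boundary \<Omega> \<and> geodesic_dist_bounded (frontier \<Omega>)"


section \<open>Meshes on the boundary\<close>

text \<open>
  An element is given by the vertex set \<open>V\<close> of a straight simplex of dimension \<open>DIM('a) - 1\<close> together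
  with a chart \<open>\<gamma>\<close>: it is the curvilinear segment or triangle \<open>\<gamma> ` (convex hull V)\<close>, with vertices
  \<open>\<gamma> ` V\<close>, and its faces are the sets \<open>\<gamma> ` (convex hull W)\<close> for \<open>W \<subseteq> V\<close>.
\<close>

type_synonym 'a element = "'a set \<times> ('a \<Rightarrow> 'a)"

definition elem_body :: "'a::euclidean_space element \<Rightarrow> 'a set" where
  "elem_body E = snd E ` (convex hull (fst E))"

definition elem_boundary :: "'a::euclidean_space element \<Rightarrow> 'a set" where
  "elem_boundary E = snd E ` rel_frontier (convex hull (fst E))"

definition elem_vertices :: "'a::euclidean_space element \<Rightarrow> 'a set" where
  "elem_vertices E = snd E ` fst E"

definition curvilinear_simplex :: "'a::euclidean_space element \<Rightarrow> bool" where
  "curvilinear_simplex E \<longleftrightarrow>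
     finite (fst E) \<and> card (fst E) = DIM('a) \<and> \<not> affine_dependent (fst E) \<and>
     regular_chart (convex hull (fst E)) (snd E)"

text \<open>
  Two distinct elements meet in a common proper face (possibly empty) with the same vertices in both;
  properness excludes listing the same element twice with different charts.
\<close>

definition conforming_pair :: "'a::euclidean_space element \<Rightarrow> 'a element \<Rightarrow> bool" where
  "conforming_pair E F \<longleftrightarrow>
     (\<exists>W X. W \<subset> fst E \<and> X \<subset> fst F \<and> snd E ` W = snd F ` X \<and>
        elem_body E \<inter> elem_body F = snd E ` (convex hull W) \<and>
        elem_body E \<inter> elem_body F = snd F ` (convex hull X))"

definition surface_mesh :: "'a::euclidean_space set \<Rightarrow> 'a element set \<Rightarrow> bool" where
  "surface_mesh \<Gamma> \<T> \<longleftrightarrow>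
     finite \<T> \<and> (\<forall>E\<in>\<T>. curvilinear_simplex E) \<and> (\<Union>E\<in>\<T>. elem_body E) = \<Gamma> \<and>
     (\<forall>E\<in>\<T>. \<forall>F\<in>\<T>. E \<noteq> F \<longrightarrow> conforming_pair E F)"

definition mesh_nodes :: "'a::euclidean_space element set \<Rightarrow> 'a set" where
  "mesh_nodes \<T> = (\<Union>E\<in>\<T>. elem_vertices E)"

definition patch :: "'a::euclidean_space element set \<Rightarrow> 'a \<Rightarrow> 'a set" where
  "patch \<T> y = (\<Union>E\<in>{E\<in>\<T>. y \<in> elem_boundary E}. elem_body E)"

definition quasi_uniform :: "real \<Rightarrow> real \<Rightarrow> 'a::euclidean_space element set \<Rightarrow> bool" where
  "quasi_uniform \<kappa> h \<T> \<longleftrightarrow>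
     (\<forall>E\<in>\<T>. h \<le> \<kappa> * diameter (elem_body E) \<and> diameter (elem_body E) \<le> \<kappa> * h)"

text \<open>
  Balls on the surface are balls for the geodesic distance; inside a flat element these are the usual
  Euclidean discs (or intervals).
\<close>

definition inscribed_diameter :: "'a::euclidean_space set \<Rightarrow> 'a set \<Rightarrow> ennreal" where
  "inscribed_diameter \<Gamma> T =
     (SUP (z, r)\<in>{(z, r). z \<in> T \<and> 0 < r \<and> {x\<in>\<Gamma>. geodesic_dist \<Gamma> z x < ennreal r} \<subseteq> T}.
        ennreal (2 * r))"

text \<open>
  For curvilinear elements, the finite element notion of shape regularity also includes a uniform
  bound on the distortion of the charts: bounded inscribed-ball ratios alone would allow arbitrarily
  thin necks. A straight element satisfies the first two conditions with \<open>\<gamma> = id\<close> and any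
  \<open>\<sigma> \<ge> 1\<close>.
\<close>

definition shape_regular :: "'a::euclidean_space set \<Rightarrow> real \<Rightarrow> 'a element set \<Rightarrow> bool" where
  "shape_regular \<Gamma> \<sigma> \<T> \<longleftrightarrow>
     (\<forall>(V, \<gamma>)\<in>\<T>.
        (\<forall>x\<in>convex hull V. \<forall>y\<in>convex hull V. dist (\<gamma> x) (\<gamma> y) \<le> \<sigma> * dist x y) \<and>
        (\<forall>x\<in>convex hull V. \<forall>y\<in>convex hull V. dist x y \<le> \<sigma> * dist (\<gamma> x) (\<gamma> y)) \<and>
        ennreal (diameter (elem_body (V, \<gamma>))) \<le>
          ennreal \<sigma> * inscribed_diameter \<Gamma> (elem_body (V, \<gamma>)))"


section \<open>Function spaces\<close>

text \<open>
  Elements of \<open>L\<^sup>2\<close> and \<open>H\<^sup>1\<^sup>/\<^sup>2\<close> are represented by functions on the ambient space, of which only the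
  restriction to the surface matters, up to null sets. Squared norms take values in \<open>[0, \<infinity>]\<close>.
\<close>

definition L2_norm_sq :: "'a::euclidean_space set \<Rightarrow> ('a \<Rightarrow> real) \<Rightarrow> ennreal" where
  "L2_norm_sq \<tau> v = (\<integral>\<^sup>+ t. ennreal ((v t)\<^sup>2) \<partial>surface_measure \<tau>)"

definition L2_norm :: "'a::euclidean_space set \<Rightarrow> ('a \<Rightarrow> real) \<Rightarrow> real" where
  "L2_norm \<tau> v = sqrt (enn2real (L2_norm_sq \<tau> v))"

definition L2_space :: "'a::euclidean_space set \<Rightarrow> ('a \<Rightarrow> real) set" where
  "L2_space \<tau> = {v. v \<in> borel_measurable (surface_measure \<tau>) \<and> L2_norm_sq \<tau> v < \<infinity>}"

definition Hhalf_seminorm_sq :: "'a::euclidean_space set \<Rightarrow> ('a \<Rightarrow> real) \<Rightarrow> ennreal" where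
  "Hhalf_seminorm_sq \<tau> v =
     (\<integral>\<^sup>+ t. (\<integral>\<^sup>+ s. ennreal (\<bar>v t - v s\<bar>\<^sup>2 / norm (t - s) ^ DIM('a)) \<partial>surface_measure \<tau>)
        \<partial>surface_measure \<tau>)"

definition Hhalf_norm_sq :: "'a::euclidean_space set \<Rightarrow> ('a \<Rightarrow> real) \<Rightarrow> ennreal" where
  "Hhalf_norm_sq \<tau> v = L2_norm_sq \<tau> v + Hhalf_seminorm_sq \<tau> v"

definition Hhalf_space :: "'a::euclidean_space set \<Rightarrow> ('a \<Rightarrow> real) set" where
  "Hhalf_space \<tau> = {v \<in> L2_space \<tau>. Hhalf_norm_sq \<tau> v < \<infinity>}"

definition ess_support :: "'a::euclidean_space set \<Rightarrow> ('a \<Rightarrow> real) \<Rightarrow> 'a set" where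
  "ess_support \<tau> f =
     {x\<in>\<tau>. \<forall>U. open U \<and> x \<in> U \<longrightarrow> \<not> (AE s in surface_measure \<tau>. s \<in> U \<longrightarrow> f s = 0)}"

text \<open>
  Operators act on representatives, so linearity and idempotence are required almost everywhere.
  That almost everywhere equal functions have almost everywhere equal images follows from linearity
  and the norm bound. \<open>B\<close> is an upper bound for the operator norm.
\<close>

definition bounded_projector ::
  "'a::euclidean_space set \<Rightarrow> real \<Rightarrow> (('a \<Rightarrow> real) \<Rightarrow> ('a \<Rightarrow> real)) \<Rightarrow> bool" where
  "bounded_projector \<Gamma> B Pr \<longleftrightarrow>
     (\<forall>v\<in>Hhalf_space \<Gamma>. Pr v \<in> Hhalf_space \<Gamma>) \<and>
     (\<forall>u\<in>Hhalf_space \<Gamma>. \<forall>v\<in>Hhalf_space \<Gamma>. \<forall>a b.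
        AE s in surface_measure \<Gamma>. Pr (\<lambda>x. a * u x + b * v x) s = a * Pr u s + b * Pr v s) \<and>
     (\<forall>v\<in>Hhalf_space \<Gamma>. AE s in surface_measure \<Gamma>. Pr (Pr v) s = Pr v s) \<and>
     (\<forall>v\<in>Hhalf_space \<Gamma>. Hhalf_norm_sq \<Gamma> (Pr v) \<le> ennreal (B\<^sup>2) * Hhalf_norm_sq \<Gamma> v)"

definition admissible_functionals ::
  "'a::euclidean_space set \<Rightarrow> 'a element set \<Rightarrow> real \<Rightarrow> real \<Rightarrow> real \<Rightarrow> ('a \<Rightarrow> 'a \<Rightarrow> real) \<Rightarrow> bool" where
  "admissible_functionals \<Gamma> \<T> h c0 C0 \<phi> \<longleftrightarrow>
     (\<forall>y\<in>mesh_nodes \<T>.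
        \<phi> y \<in> L2_space \<Gamma> \<and>
        (LINT s|surface_measure \<Gamma>. \<phi> y s) = 1 \<and>
        ess_support \<Gamma> (\<phi> y) \<subseteq> patch \<T> y \<and>
        c0 * h powr (1/2 - real DIM('a) / 2) \<le> L2_norm (patch \<T> y) (\<phi> y) \<and>
        L2_norm (patch \<T> y) (\<phi> y) \<le> C0 * h powr (1/2 - real DIM('a) / 2))"

end

theory Submission
  imports Defs
begin

text \<open>
  Let \<open>w = v - \<Pi> v\<close>. Since \<open>\<integral> w \<phi>\<^sub>y = 0\<close> and \<open>\<integral> \<phi>\<^sub>y = 1\<close>, we have \<open>w t = \<integral> (w t - w s) \<phi>\<^sub>y s ds\<close> for \<open>t\<close> in the patch
  of \<open>y\<close>, and the Cauchy-Schwarz inequality gives \<open>\<parallel>w\<parallel>\<^sup>2 \<le> C h |w|\<^sup>2\<close> on every patch. In the double integral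
  \<open>|w|\<^sup>2\<close> over the whole boundary, pairs of points in a common patch are accounted for by the sum over the
  patches. All other pairs are at distance at least \<open>c h\<close>, because disjoint elements are; on them
  \<open>|w t - w s|\<^sup>2 \<le> 2 |w t|\<^sup>2 + 2 |w s|\<^sup>2\<close>, and the kernel integrates to at most \<open>C / h\<close> since balls of radius \<open>r\<close> have
  surface measure at most \<open>A r\<^sup>n\<^sup>-\<^sup>1\<close>. The powers of \<open>h\<close> cancel. Conversely, almost every point lies in at most
  \<open>n\<close> patches.

  Only upper bounds for the Hausdorff measure are needed: were the outer measure not additive on Borel
  sets, then \<^const>\<open>measure_of\<close> would yield the zero measure.
\<close>

text \<open>The separation of disjoint elements is where the work lies. Shape regularity speaks of
  geodesic balls on \<Gamma>, whereas estimates inside an element need a ball in the flat simplex.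
  The passage combines the comparability of geodesic and Euclidean distance with topology: a ball of
  \<Gamma> contained in an element avoids the boundary of that element. The resulting radius makes
  every barycentric coordinate Lipschitz with a constant of order 1 / h, which acts as a minimal
  angle condition for curved elements.

  Separation itself comes from connectedness. Two close points are joined inside \<Gamma> by a short
  curve, which has to pass from the elements around a vertex or an edge to other elements. The point
  of passage lies in a common face, where the barycentric estimates apply. As n is at most 3, a
  nonempty common face is a vertex or an edge.

  The factor h in the patch estimate is the product of h^(1-n), the order of the squared norm of a
  test function, and h^n, the order of the n-th power of a patch diameter.\<close>

section \<open>Upper bounds for the Hausdorff measure\<close>

lemma sets_hausdorff_measure [simp, measurable_cong]: "sets (hausdorff_measure s) = sets borel"
  unfolding hausdorff_measure_def by (metis sets.sets_measure_of_eq space_borel)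

lemma space_hausdorff_measure [simp]: "space (hausdorff_measure s) = UNIV"
  by (metis sets_eq_imp_space_eq sets_hausdorff_measure space_borel)

text \<open>\<open>measure_of\<close> returns either the value of its set function or 0, and both
  are at most the outer measure, for any set \<open>A\<close>.\<close>

lemma emeasure_hausdorff_le: "emeasure (hausdorff_measure s) A \<le> hausdorff_outer s A"
  unfolding hausdorff_measure_def emeasure_measure_of_conv by auto

text \<open>A finite cover is padded to a sequence by empty sets, which the definition counts as 0
  even for \<open>s = 0\<close>, where \<open>0 ^ 0 = 1\<close> would charge for them.\<close>

lemma hausdorff_outer_le_finite_cover:
  fixes A :: "'a::euclidean_space set"
  assumes "\<And>\<delta>. \<delta> > 0 \<Longrightarrow> \<exists>\<C> d. finite \<C> \<and> A \<subseteq> \<Union>\<C> \<and> 0 \<le> d \<and> d \<le> \<delta> \<and>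
      (\<forall>C\<in>\<C>. bounded C \<and> diameter C \<le> d) \<and> real (card \<C>) * (unit_ball_vol (real s) * (d / 2) ^ s) \<le> b"
  shows "hausdorff_outer s A \<le> ennreal b"
  unfolding hausdorff_outer_def
proof (rule SUP_least)
  fix \<delta> :: real assume "\<delta> \<in> {0<..}"
  then obtain \<C> d where C: "finite \<C>" "A \<subseteq> \<Union>\<C>" "0 \<le> d" "d \<le> \<delta>"
      "\<And>C. C \<in> \<C> \<Longrightarrow> bounded C \<and> diameter C \<le> d"
      "real (card \<C>) * (unit_ball_vol (real s) * (d / 2) ^ s) \<le> b"
    using assms[of \<delta>] by force
  define k where "k = card \<C>"
  obtain f where f: "bij_betw f {..<k} \<C>"
    using ex_bij_betw_nat_finite[OF C(1)] by (auto simp: k_def lessThan_atLeast0)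
  define g where "g i = (if i < k then f i else {})" for i
  have fC: "f i \<in> \<C>" if "i < k" for i using f that by (auto simp: bij_betw_def)
  have "A \<subseteq> (\<Union>i. g i)"
  proof
    fix x assume "x \<in> A"
    then obtain X where "X \<in> \<C>" "x \<in> X" using C(2) by auto
    then obtain i where "i < k" "f i = X" using f by (force simp: bij_betw_def)
    then show "x \<in> (\<Union>i. g i)" using \<open>x \<in> X\<close> by (auto simp: g_def intro!: exI[of _ i])
  qed
  moreover have "bounded (g i) \<and> diameter (g i) \<le> \<delta>" for i
    using C(5)[OF fC[of i]] C(3,4) by (auto simp: g_def)
  ultimately have g: "g \<in> {C. (\<forall>i. bounded (C i) \<and> diameter (C i) \<le> \<delta>) \<and> A \<subseteq> (\<Union>i. C i)}"
    by auto
  let ?t = "\<lambda>X :: 'a set. if X = {} then 0 else ennreal (unit_ball_vol (real s) * (diameter X / 2) ^ s)"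
  have t: "?t (g i) \<le> ennreal (unit_ball_vol (real s) * (d / 2) ^ s)" if "i < k" for i
  proof (cases "g i = {}")
    case False
    then have "bounded (g i)" "diameter (g i) \<le> d" using C(5)[OF fC[OF that]] that by (auto simp: g_def)
    then show ?thesis using False diameter_ge_0[of "g i"] unit_ball_vol_nonneg[of "real s"]
      by (auto intro!: ennreal_leI mult_left_mono power_mono)
  qed auto
  have "(INF C\<in>{C. (\<forall>i. bounded (C i) \<and> diameter (C i) \<le> \<delta>) \<and> A \<subseteq> (\<Union>i. C i)}. \<Sum>i. ?t (C i))
      \<le> (\<Sum>i. ?t (g i))"
    using g by (rule INF_lower)
  also have "\<dots> = (\<Sum>i<k. ?t (g i))"
    by (rule suminf_finite) (auto simp: g_def)
  also have "\<dots> \<le> (\<Sum>i<k. ennreal (unit_ball_vol (real s) * (d / 2) ^ s))"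
    using t by (intro sum_mono) auto
  also have "\<dots> = ennreal (real k * (unit_ball_vol (real s) * (d / 2) ^ s))"
    using C(3) unit_ball_vol_nonneg[of "real s"]
    by (subst sum_ennreal) auto
  also have "\<dots> \<le> ennreal b" using C(6) by (auto simp: k_def intro: ennreal_leI)
  finally show "(INF C\<in>{C. (\<forall>i. bounded (C i) \<and> diameter (C i) \<le> \<delta>) \<and> A \<subseteq> (\<Union>i. C i)}. \<Sum>i. ?t (C i))
      \<le> ennreal b" .
qed

text \<open>A grid of mesh size \<open>d / N\<close> with respect to an orthonormal basis of \<open>U\<close>, transported by \<open>f\<close>.\<close>

lemma lipschitz_image_cover:
  fixes S U :: "'a::euclidean_space set" and f :: "'a \<Rightarrow> 'b::euclidean_space"
  assumes U: "subspace U" "dim U = k" and SU: "\<And>x y. x \<in> S \<Longrightarrow> y \<in> S \<Longrightarrow> x - y \<in> U"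
    and Sd: "\<And>x y. x \<in> S \<Longrightarrow> y \<in> S \<Longrightarrow> dist x y \<le> d" and "d > 0"
    and f: "\<And>x y. x \<in> S \<Longrightarrow> y \<in> S \<Longrightarrow> dist (f x) (f y) \<le> L * dist x y" and "L \<ge> 0" and "N \<ge> (1::nat)"
  shows "\<exists>\<C>. finite \<C> \<and> card \<C> \<le> (3 * N) ^ k \<and> f ` S \<subseteq> \<Union>\<C> \<and>
    (\<forall>C\<in>\<C>. bounded C \<and> diameter C \<le> L * real k * d / real N)"
proof (cases "S = {}")
  case True
  then show ?thesis by (auto intro!: exI[of _ "{}"])
next
  case False
  then obtain x0 where x0: "x0 \<in> S" by auto
  obtain B where B: "B \<subseteq> U" "pairwise orthogonal B" "\<And>x. x \<in> B \<Longrightarrow> norm x = 1" "independent B"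
     "card B = dim U" "span B = U" using orthonormal_basis_subspace[OF U(1)] by blast
  have finB: "finite B" using B(4) independent_imp_finite by auto
  \<comment> \<open>Coordinates relative to \<open>x0\<close> lie in [-d, d]. The shift by
    \<open>d\<close> makes them nonnegative, so that \<open>nat\<close> loses nothing, and the floor
    is at most 2 N, hence below 3 N.\<close>
  define q where "q x b = nat \<lfloor>(b \<bullet> (x - x0) + d) * (real N / d)\<rfloor>" for x b
  define c where "c x = restrict (q x) B" for x
  define I where "I = B \<rightarrow>\<^sub>E {..< 3 * N}"
  define D where "D i = f ` {x \<in> S. c x = i}" for i
  have coord: "\<bar>b \<bullet> (x - y)\<bar> \<le> dist x y" if "b \<in> B" for x y b
    using Cauchy_Schwarz_ineq2[of b "x - y"] B(3)[OF that] by (simp add: dist_norm)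
  have cI: "c x \<in> I" if "x \<in> S" for x
    unfolding c_def I_def
  proof (rule restrict_PiE_iff[THEN iffD2], safe)
    fix b assume b: "b \<in> B"
    have *: "\<bar>b \<bullet> (x - x0)\<bar> \<le> d" using coord[OF b, of x x0] Sd[OF that x0] by simp
    then have "(b \<bullet> (x - x0) + d) * (real N / d) \<le> (2 * d) * (real N / d)"
      using \<open>d > 0\<close> by (intro mult_right_mono) auto
    also have "\<dots> = 2 * real N" using \<open>d > 0\<close> by simp
    finally have "\<lfloor>(b \<bullet> (x - x0) + d) * (real N / d)\<rfloor> \<le> 2 * int N" by linarith
    then show "q x b < 3 * N" using \<open>N \<ge> 1\<close> unfolding q_def by linarith
  qed
  have close: "dist x y \<le> real k * (d / real N)" if xy: "x \<in> S" "y \<in> S" "c x = c y" for x y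
  proof -
    have bd: "\<bar>b \<bullet> (x - y)\<bar> \<le> d / real N" if b: "b \<in> B" for b
    proof -
      have pos: "(b \<bullet> (z - x0) + d) * (real N / d) \<ge> 0" if "z \<in> S" for z
        using coord[OF b, of z x0] Sd[OF that x0] \<open>d > 0\<close> by (intro mult_nonneg_nonneg) auto
      have "q x b = q y b" using xy(3) b by (metis c_def restrict_apply')
      then have "\<lfloor>(b \<bullet> (x - x0) + d) * (real N / d)\<rfloor> = \<lfloor>(b \<bullet> (y - x0) + d) * (real N / d)\<rfloor>"
        using pos[OF xy(1)] pos[OF xy(2)] unfolding q_def
        by (metis eq_nat_nat_iff zero_le_floor)
      then have "\<bar>(b \<bullet> (x - x0) + d) * (real N / d) - (b \<bullet> (y - x0) + d) * (real N / d)\<bar> \<le> 1"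
        by linarith
      also have "(b \<bullet> (x - x0) + d) * (real N / d) - (b \<bullet> (y - x0) + d) * (real N / d)
          = b \<bullet> (x - y) * (real N / d)" by (simp add: algebra_simps inner_diff_right flip: diff_divide_distrib)
      finally have "\<bar>b \<bullet> (x - y)\<bar> * (real N / d) \<le> 1" using \<open>d > 0\<close> by (simp add: abs_mult)
      then show ?thesis using \<open>d > 0\<close> \<open>N \<ge> 1\<close> by (simp add: field_simps)
    qed
    have "x - y = (\<Sum>b\<in>B. (b \<bullet> (x - y)) *\<^sub>R b)"
    proof -
      have "x - y \<in> span B" using SU xy B(6) by auto
      then show ?thesis using orthonormal_basis_expand[of B "x - y"] B finB 
        by (simp add: inner_commute)
    qed
    then have "norm (x - y) \<le> (\<Sum>b\<in>B. norm ((b \<bullet> (x - y)) *\<^sub>R b))"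
      by (metis norm_sum)
    also have "\<dots> \<le> (\<Sum>b\<in>B. d / real N)" using bd B(3) by (intro sum_mono) auto
    also have "\<dots> = real k * (d / real N)" using B(5) U(2) by simp
    finally show ?thesis by (simp add: dist_norm)
  qed
  have dD: "dist u v \<le> L * real k * d / real N" if "u \<in> D i" "v \<in> D i" for u v i
  proof -
    obtain x y where xy: "x \<in> S" "y \<in> S" "c x = c y" "u = f x" "v = f y"
      using \<open>u \<in> D i\<close> \<open>v \<in> D i\<close> unfolding D_def by auto
    have "dist u v \<le> L * dist x y" using f xy by simp
    also have "\<dots> \<le> L * (real k * (d / real N))" using close[OF xy(1-3)] \<open>L \<ge> 0\<close> by (intro mult_left_mono)
    finally show ?thesis by (simp add: mult.assoc)
  qed
  show ?thesis
  proof (intro exI[of _ "D ` I"] conjI ballI)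
    have fI: "finite I" unfolding I_def using finB by (intro finite_PiE) auto
    then show "finite (D ` I)" by simp
    have "card I = (3 * N) ^ k" unfolding I_def using B(5) U(2) finB by (simp add: card_PiE)
    then show "card (D ` I) \<le> (3 * N) ^ k" using card_image_le[OF fI, of D] by simp
    show "f ` S \<subseteq> \<Union>(D ` I)" using cI by (auto simp: D_def)
    fix C assume "C \<in> D ` I"
    then obtain i where C: "C = D i" by auto
    show "diameter C \<le> L * real k * d / real N"
      unfolding C using dD[of _ i] \<open>d > 0\<close> \<open>L \<ge> 0\<close> by (auto simp: dist_norm intro!: diameter_le)
    show "bounded C" unfolding C bounded_any_center
      by (metis bounded_def bounded_any_center dD)
  qed
qed

text \<open>The grid gives at most (3 N)^k pieces of diameter at most L k d / N. As the exponent of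
  the measure equals the dimension, N cancels and may be taken as large as \<delta> demands.\<close>

lemma hausdorff_outer_lipschitz_image_le:
  fixes S U :: "'a::euclidean_space set" and f :: "'a \<Rightarrow> 'b::euclidean_space"
  assumes U: "subspace U" "dim U = k" and SU: "\<And>x y. x \<in> S \<Longrightarrow> y \<in> S \<Longrightarrow> x - y \<in> U"
    and Sd: "\<And>x y. x \<in> S \<Longrightarrow> y \<in> S \<Longrightarrow> dist x y \<le> d" and "d > 0"
    and f: "\<And>x y. x \<in> S \<Longrightarrow> y \<in> S \<Longrightarrow> dist (f x) (f y) \<le> L * dist x y" and "L \<ge> 0"
  shows "hausdorff_outer k (f ` S) \<le> ennreal (unit_ball_vol (real k) * (3 * L * real k * d / 2) ^ k)"
proof (rule hausdorff_outer_le_finite_cover)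
  fix \<delta> :: real assume "\<delta> > 0"
  obtain N :: nat where N: "real N > L * real k * d / \<delta>" using reals_Archimedean2 by blast
  have "0 \<le> L * real k * d / \<delta>" using assms \<open>\<delta> > 0\<close> by simp
  then have N0: "N \<ge> 1" using N by linarith
  then have N1: "L * real k * d / real N \<le> \<delta>"
    using N \<open>\<delta> > 0\<close> by (simp add: field_simps)
  obtain \<C> where C: "finite \<C>" "card \<C> \<le> (3 * N) ^ k" "f ` S \<subseteq> \<Union>\<C>"
    "\<forall>C\<in>\<C>. bounded C \<and> diameter C \<le> L * real k * d / real N"
    using lipschitz_image_cover[of U k S d f L N] assms N0 by blast
  let ?d = "L * real k * d / real N"
  have "?d \<ge> 0" and "?d / 2 \<ge> 0" using assms by simp_all
  have "real (card \<C>) * (unit_ball_vol (real k) * (?d / 2) ^ k)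
      \<le> (3 * real N) ^ k * (unit_ball_vol (real k) * (?d / 2) ^ k)"
  proof (rule mult_right_mono)
    show "real (card \<C>) \<le> (3 * real N) ^ k" using C(2) by (metis of_nat_le_iff of_nat_mult of_nat_numeral of_nat_power)
  qed (use \<open>?d / 2 \<ge> 0\<close> in \<open>intro mult_nonneg_nonneg zero_le_power unit_ball_vol_nonneg; simp only: of_nat_0_le_iff\<close>)
  also have "\<dots> = unit_ball_vol (real k) * ((3 * real N) * (?d / 2)) ^ k"
    unfolding power_mult_distrib[of "3 * real N" "?d / 2"] by (rule mult.left_commute)
  also have "(3 * real N) * (?d / 2) = 3 * L * real k * d / 2" using N0 by simp
  finally show "\<exists>\<C> d'. finite \<C> \<and> f ` S \<subseteq> \<Union>\<C> \<and> 0 \<le> d' \<and> d' \<le> \<delta> \<and>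
      (\<forall>C\<in>\<C>. bounded C \<and> diameter C \<le> d') \<and>
      real (card \<C>) * (unit_ball_vol (real k) * (d' / 2) ^ k)
        \<le> unit_ball_vol (real k) * (3 * L * real k * d / 2) ^ k"
    using C N1 \<open>?d \<ge> 0\<close> by blast
qed

text \<open>The same grids, weighed with an exponent \<open>s\<close> above the dimension, leave a
  factor N^(k-s), at most 1 / N.\<close>

lemma hausdorff_outer_lipschitz_image_eq_0:
  fixes S U :: "'a::euclidean_space set" and f :: "'a \<Rightarrow> 'b::euclidean_space"
  assumes U: "subspace U" "dim U = k" and SU: "\<And>x y. x \<in> S \<Longrightarrow> y \<in> S \<Longrightarrow> x - y \<in> U"
    and Sd: "\<And>x y. x \<in> S \<Longrightarrow> y \<in> S \<Longrightarrow> dist x y \<le> d" and "d > 0"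
    and f: "\<And>x y. x \<in> S \<Longrightarrow> y \<in> S \<Longrightarrow> dist (f x) (f y) \<le> L * dist x y" and "L \<ge> 0"
    and "k < s"
  shows "hausdorff_outer s (f ` S) = 0"
proof -
  have "hausdorff_outer s (f ` S) \<le> ennreal \<epsilon>" if "\<epsilon> > 0" for \<epsilon>
  proof (rule hausdorff_outer_le_finite_cover)
    fix \<delta> :: real assume "\<delta> > 0"
    define K where "K = 3 ^ k * unit_ball_vol (real s) * (L * real k * d / 2) ^ s"
    have "K \<ge> 0" unfolding K_def using assms by auto
    obtain N :: nat where N: "real N > max (L * real k * d / \<delta>) (K / \<epsilon>)" using reals_Archimedean2 by blast
    have "0 \<le> L * real k * d / \<delta>" using assms \<open>\<delta> > 0\<close> by simp
    then have N0: "N \<ge> 1" using N by linarith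
    then have N1: "L * real k * d / real N \<le> \<delta>"
      using N \<open>\<delta> > 0\<close> by (simp add: field_simps)
    obtain \<C> where C: "finite \<C>" "card \<C> \<le> (3 * N) ^ k" "f ` S \<subseteq> \<Union>\<C>"
      "\<forall>C\<in>\<C>. bounded C \<and> diameter C \<le> L * real k * d / real N"
      using lipschitz_image_cover[of U k S d f L N] assms(1-7) N0 by blast
    let ?d = "L * real k * d / real N"
    have "?d \<ge> 0" and "?d / 2 \<ge> 0" using assms by simp_all
    have "real (card \<C>) * (unit_ball_vol (real s) * (?d / 2) ^ s)
        \<le> (3 * real N) ^ k * (unit_ball_vol (real s) * (?d / 2) ^ s)"
    proof (rule mult_right_mono)
      show "real (card \<C>) \<le> (3 * real N) ^ k" using C(2) by (metis of_nat_le_iff of_nat_mult of_nat_numeral of_nat_power)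
    qed (use \<open>?d / 2 \<ge> 0\<close> in \<open>intro mult_nonneg_nonneg zero_le_power unit_ball_vol_nonneg; simp only: of_nat_0_le_iff\<close>)
    also have "\<dots> = K * (real N ^ k / real N ^ s)"
      unfolding K_def using N0 by (simp add: power_mult_distrib power_divide field_simps)
    also have "\<dots> \<le> K * (1 / real N)"
    proof (rule mult_left_mono[OF _ \<open>K \<ge> 0\<close>])
      have "real N ^ k * real N \<le> real N ^ s"
        using power_increasing[of "Suc k" s "real N"] N0 \<open>k < s\<close> by (simp add: mult.commute)
      then show "real N ^ k / real N ^ s \<le> 1 / real N" using N0 by (simp add: field_simps)
    qed
    also have "\<dots> \<le> \<epsilon>" using N N0 that by (simp add: field_simps)
    finally show "\<exists>\<C> d'. finite \<C> \<and> f ` S \<subseteq> \<Union>\<C> \<and> 0 \<le> d' \<and> d' \<le> \<delta> \<and>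
      (\<forall>C\<in>\<C>. bounded C \<and> diameter C \<le> d') \<and>
      real (card \<C>) * (unit_ball_vol (real s) * (d' / 2) ^ s) \<le> \<epsilon>"
      using C N1 \<open>?d \<ge> 0\<close> by blast
  qed
  then show ?thesis
    by (metis ennreal_le_epsilon add_0 le_zero_eq zero_le)
qed

section \<open>Lipschitz boundaries\<close>

text \<open>A point above the graph has a neighbourhood free of \<Omega>. A point on the graph is
  approached from \<Omega> by moving against \<open>e\<close>, which leaves the component orthogonal
  to \<open>e\<close>, and with it the value of \<phi>, unchanged.\<close>

lemma frontier_Int_eq_graph:
  fixes \<Omega> U :: "'a::euclidean_space set" and \<phi> :: "'a \<Rightarrow> real"
  assumes "open \<Omega>" "open U" and e: "norm e = 1" and lip: "L-lipschitz_on UNIV \<phi>"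
    and eq: "\<Omega> \<inter> U = {y\<in>U. y \<bullet> e < \<phi> (y - (y \<bullet> e) *\<^sub>R e)}"
  shows "frontier \<Omega> \<inter> U = {y\<in>U. y \<bullet> e = \<phi> (y - (y \<bullet> e) *\<^sub>R e)}"
proof -
  have cont: "continuous_on UNIV \<phi>" using lip by (rule lipschitz_on_continuous_on)
  have c2: "continuous_on UNIV (\<lambda>y. \<phi> (y - (y \<bullet> e) *\<^sub>R e))"
    by (rule continuous_on_compose2[OF cont]) (auto intro!: continuous_intros)
  have mem: "y \<in> \<Omega> \<longleftrightarrow> y \<bullet> e < \<phi> (y - (y \<bullet> e) *\<^sub>R e)" if "y \<in> U" for y
    using set_eq_iff[THEN iffD1, OF eq, rule_format, of y] that by simp
  have fr: "frontier \<Omega> = closure \<Omega> - \<Omega>" using \<open>open \<Omega>\<close> by (simp add: frontier_def interior_open)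
  have ee: "e \<bullet> e = 1" using e by (simp add: dot_square_norm)
  show ?thesis
  proof (intro equalityI subsetI)
    fix y assume y: "y \<in> frontier \<Omega> \<inter> U"
    then have 1: "\<not> y \<bullet> e < \<phi> (y - (y \<bullet> e) *\<^sub>R e)" using mem[of y] fr by auto
    have "\<not> y \<bullet> e > \<phi> (y - (y \<bullet> e) *\<^sub>R e)"
    proof
      assume *: "y \<bullet> e > \<phi> (y - (y \<bullet> e) *\<^sub>R e)"
      define N where "N = {z. z \<bullet> e > \<phi> (z - (z \<bullet> e) *\<^sub>R e)} \<inter> U"
      have "open N" unfolding N_def using c2 \<open>open U\<close>
        by (intro open_Int open_Collect_less) (auto intro!: continuous_intros)
      moreover have "y \<in> N" using * y by (auto simp: N_def)
      moreover have "N \<inter> \<Omega> = {}" using mem by (force simp: N_def)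
      ultimately have "y \<notin> closure \<Omega>" by (metis disjoint_iff open_Int_closure_eq_empty)
      then show False using y fr by auto
    qed
    then show "y \<in> {y\<in>U. y \<bullet> e = \<phi> (y - (y \<bullet> e) *\<^sub>R e)}" using 1 y by auto
  next
    fix y assume y: "y \<in> {y\<in>U. y \<bullet> e = \<phi> (y - (y \<bullet> e) *\<^sub>R e)}"
    then have "y \<notin> \<Omega>" using mem[of y] by auto
    moreover have "y \<in> closure \<Omega>"
      unfolding closure_approachable
    proof (intro allI impI)
      fix \<epsilon> :: real assume "\<epsilon> > 0"
      obtain \<delta> where \<delta>: "\<delta> > 0" "ball y \<delta> \<subseteq> U" using \<open>open U\<close> y open_contains_ball by blast
      define t where "t = min \<epsilon> \<delta> / 2"
      have t: "0 < t" "t < \<epsilon>" "t < \<delta>" using \<open>\<epsilon> > 0\<close> \<delta> by (auto simp: t_def)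
      define z where "z = y - t *\<^sub>R e"
      have "dist y z = t" using t e by (simp add: z_def dist_norm)
      then have "z \<in> U" using \<delta> t by auto
      moreover have "z \<bullet> e = y \<bullet> e - t" by (simp add: z_def inner_diff_left ee)
      moreover have "z - (z \<bullet> e) *\<^sub>R e = y - (y \<bullet> e) *\<^sub>R e"
        unfolding \<open>z \<bullet> e = y \<bullet> e - t\<close> by (simp add: z_def algebra_simps)
      ultimately have "z \<in> \<Omega>" using mem[of z] y t by auto
      then show "\<exists>z\<in>\<Omega>. dist z y < \<epsilon>" using \<open>dist y z = t\<close> t by (auto simp: dist_commute)
    qed
    ultimately show "y \<in> frontier \<Omega> \<inter> U" using y fr by auto
  qed
qed

lemma norm_orthogonal_part_le:
  assumes "norm e = 1"
  shows "norm (y - (y \<bullet> e) *\<^sub>R e) \<le> norm (y :: 'a::euclidean_space)"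
proof -
  have "e \<bullet> e = 1" using assms by (simp add: dot_square_norm)
  then have "(norm (y - (y \<bullet> e) *\<^sub>R e))\<^sup>2 = (norm y)\<^sup>2 - (y \<bullet> e)\<^sup>2"
    unfolding power2_norm_eq_inner
    by (simp add: inner_diff_left inner_diff_right inner_commute power2_eq_square)
  also have "\<dots> \<le> (norm y)\<^sup>2" by simp
  finally show ?thesis by (rule power2_le_imp_le) simp
qed

lemma lipschitz_graph_map:
  fixes \<phi> :: "'a::euclidean_space \<Rightarrow> real"
  assumes "norm e = 1" and lip: "L-lipschitz_on UNIV \<phi>"
  shows "dist (p + \<phi> p *\<^sub>R e) (q + \<phi> q *\<^sub>R e) \<le> (1 + L) * dist p q"
proof -
  have "dist (p + \<phi> p *\<^sub>R e) (q + \<phi> q *\<^sub>R e) = norm ((p - q) + (\<phi> p - \<phi> q) *\<^sub>R e)"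
    by (simp add: dist_norm algebra_simps)
  also have "\<dots> \<le> norm (p - q) + \<bar>\<phi> p - \<phi> q\<bar>"
    using norm_triangle_ineq[of "p - q" "(\<phi> p - \<phi> q) *\<^sub>R e"] assms(1) by simp
  also have "\<dots> \<le> dist p q + L * dist p q"
    using lipschitz_onD[OF lip, of p q] by (simp add: dist_norm)
  finally show ?thesis by (simp add: algebra_simps)
qed

text \<open>Projection along \<open>e\<close> takes the boundary inside a ball of radius r to a set
  of diameter at most 2 r in a hyperplane, and the graph map going back is (1 + L)-Lipschitz.
  Compactness reduces the local constants to finitely many, which are added.\<close>

proposition lipschitz_boundary_upper_regular:
  fixes \<Omega> :: "'a::euclidean_space set"
  assumes "open \<Omega>" "bounded \<Omega>" "lipschitz_boundary \<Omega>"
  shows "\<exists>A>0. \<forall>x. \<forall>r>0. emeasure (hausdorff_measure (DIM('a) - 1)) (frontier \<Omega> \<inter> ball x r)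
            \<le> ennreal (A * r ^ (DIM('a) - 1))"
proof -
  let ?m = "DIM('a) - 1"
  let ?H = "hausdorff_measure ?m :: 'a measure"
  define good where "good U \<longleftrightarrow> open U \<and> (\<exists>a\<ge>0. \<forall>x. \<forall>r>0.
     emeasure ?H (frontier \<Omega> \<inter> U \<inter> ball x r) \<le> ennreal (a * r ^ ?m))" for U
  have "\<exists>U. good U \<and> z \<in> U" if z: "z \<in> frontier \<Omega>" for z
  proof -
    obtain U e and \<phi> :: "'a \<Rightarrow> real" and L where U: "open U" "z \<in> U" "norm e = 1" "L-lipschitz_on UNIV \<phi>"
        "\<Omega> \<inter> U = {y\<in>U. y \<bullet> e < \<phi> (y - (y \<bullet> e) *\<^sub>R e)}"
      using assms(3)[unfolded lipschitz_boundary_def, rule_format, OF z]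
      by (elim exE conjE) (rule that; assumption)
    note graph = frontier_Int_eq_graph[OF assms(1) U(1,3,4,5)]
    have ee: "e \<bullet> e = 1" "e \<noteq> 0" using U(3) by (auto simp: dot_square_norm)
    have "L \<ge> 0" using U(4) by (rule lipschitz_on_nonneg)
    let ?P = "\<lambda>y. y - (y \<bullet> e) *\<^sub>R e"
    let ?f = "\<lambda>p. p + \<phi> p *\<^sub>R e"
    have "emeasure ?H (frontier \<Omega> \<inter> U \<inter> ball x r)
        \<le> ennreal ((unit_ball_vol (real ?m) * (3 * (1 + L) * real ?m) ^ ?m) * r ^ ?m)" if "r > 0" for x r
    proof -
      let ?X = "frontier \<Omega> \<inter> U \<inter> ball x r"
      have img: "?X = ?f ` ?P ` ?X"
      proof -
        have "?f (?P y) = y" if "y \<in> ?X" for y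
        proof -
          have "y \<in> {y\<in>U. y \<bullet> e = \<phi> (?P y)}" using that graph by blast
          then show ?thesis by simp
        qed
        then have "(\<lambda>y. ?f (?P y)) ` ?X = (\<lambda>y. y) ` ?X" by (rule image_cong[OF refl])
        then show ?thesis by (simp only: image_image image_ident)
      qed
      have "emeasure ?H ?X \<le> hausdorff_outer ?m ?X" by (rule emeasure_hausdorff_le)
      also have "\<dots> = hausdorff_outer ?m (?f ` ?P ` ?X)" by (rule arg_cong[OF img])
      also have "\<dots> \<le>
          ennreal (unit_ball_vol (real ?m) * (3 * (1 + L) * real ?m * (2 * r) / 2) ^ ?m)"
      proof (rule hausdorff_outer_lipschitz_image_le)
        show "subspace {y. e \<bullet> y = 0}" by (rule subspace_hyperplane)
        show "dim {y. e \<bullet> y = 0} = ?m" using ee(2) by (rule dim_hyperplane)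
        show "p - q \<in> {y. e \<bullet> y = 0}" if "p \<in> ?P ` ?X" "q \<in> ?P ` ?X" for p q
          using that ee by (auto simp: inner_diff_right inner_commute)
        show "dist p q \<le> 2 * r" if p: "p \<in> ?P ` ?X" and q: "q \<in> ?P ` ?X" for p q
        proof -
          obtain u v where uv: "u \<in> ?X" "v \<in> ?X" "p = ?P u" "q = ?P v" using p q by blast
          have "p - q = ?P (u - v)" using uv by (simp add: algebra_simps inner_diff_left)
          then have "dist p q \<le> dist u v" using norm_orthogonal_part_le[OF U(3), of "u - v"] by (simp add: dist_norm)
          also have "\<dots> \<le> dist x u + dist x v" by (rule dist_triangle3)
          finally show ?thesis using uv by auto
        qed
        show "dist (?f p) (?f q) \<le> (1 + L) * dist p q" for p q by (rule lipschitz_graph_map[OF U(3,4)])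
      qed (use \<open>r > 0\<close> \<open>L \<ge> 0\<close> in auto)
      also have "unit_ball_vol (real ?m) * (3 * (1 + L) * real ?m * (2 * r) / 2) ^ ?m
          = (unit_ball_vol (real ?m) * (3 * (1 + L) * real ?m) ^ ?m) * r ^ ?m"
        by (simp add: power_mult_distrib)
      finally show ?thesis .
    qed
    then show ?thesis using U(1,2) \<open>L \<ge> 0\<close> unfolding good_def
      by (intro exI[of _ U] conjI exI[of _ "unit_ball_vol (real ?m) * (3 * (1 + L) * real ?m) ^ ?m"]) auto
  qed
  then obtain W where W: "\<And>z. z \<in> frontier \<Omega> \<Longrightarrow> good (W z) \<and> z \<in> W z" by metis
  have "compact (frontier \<Omega>)" using assms(2) by (rule compact_frontier_bounded)
  then obtain Z where Z: "finite Z" "Z \<subseteq> frontier \<Omega>" "frontier \<Omega> \<subseteq> (\<Union>z\<in>Z. W z)"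
    by (rule compactE_image[of _ "frontier \<Omega>" W]) (use W in \<open>auto simp: good_def\<close>)
  have "\<forall>z\<in>Z. \<exists>a\<ge>0. \<forall>x. \<forall>r>0. emeasure ?H (frontier \<Omega> \<inter> W z \<inter> ball x r) \<le> ennreal (a * r ^ ?m)"
    using W Z(2) by (auto simp: good_def subset_iff)
  then obtain a where a: "\<And>z. z \<in> Z \<Longrightarrow> a z \<ge> 0"
    "\<And>z x r. z \<in> Z \<Longrightarrow> r > 0 \<Longrightarrow> emeasure ?H (frontier \<Omega> \<inter> W z \<inter> ball x r) \<le> ennreal (a z * r ^ ?m)"
    by metis
  \<comment> \<open>The summand 1 keeps the constant positive even when \<open>Z\<close> is
    empty.\<close>
  have "emeasure ?H (frontier \<Omega> \<inter> ball x r) \<le> ennreal ((sum a Z + 1) * r ^ ?m)" if "r > 0" for x r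
  proof -
    have ms: "frontier \<Omega> \<inter> W z \<inter> ball x r \<in> sets ?H" if "z \<in> Z" for z
      using W[of z] Z(2) that unfolding sets_hausdorff_measure good_def by auto
    have "frontier \<Omega> \<inter> ball x r \<subseteq> (\<Union>z\<in>Z. frontier \<Omega> \<inter> W z \<inter> ball x r)" using Z(3) by auto
    then have "emeasure ?H (frontier \<Omega> \<inter> ball x r) \<le> emeasure ?H (\<Union>z\<in>Z. frontier \<Omega> \<inter> W z \<inter> ball x r)"
      by (rule emeasure_mono) (intro sets.finite_UN Z(1) ms)
    also have "\<dots> \<le> (\<Sum>z\<in>Z. emeasure ?H (frontier \<Omega> \<inter> W z \<inter> ball x r))"
      using ms by (intro emeasure_subadditive_finite Z(1)) auto
    also have "\<dots> \<le> (\<Sum>z\<in>Z. ennreal (a z * r ^ ?m))" using a(2) that by (intro sum_mono) auto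
    also have "\<dots> = ennreal (\<Sum>z\<in>Z. a z * r ^ ?m)" using a(1) that by (intro sum_ennreal) auto
    also have "\<dots> \<le> ennreal ((sum a Z + 1) * r ^ ?m)"
      using that by (intro ennreal_leI) (simp add: sum_distrib_right[symmetric] algebra_simps)
    finally show ?thesis .
  qed
  moreover have "sum a Z + 1 > 0" using sum_nonneg[of Z a] a(1) by fastforce
  ultimately show ?thesis by blast
qed

text \<open>Invariance of domain: the boundary is locally homeomorphic to a hyperplane, so a closed simplex
  embedded in it does not cover a neighbourhood of a point on its relative boundary.\<close>

lemma rel_frontier_not_covered:
  fixes \<Omega> V :: "'a::euclidean_space set" and \<gamma> :: "'a \<Rightarrow> 'a"
  assumes "open \<Omega>" "lipschitz_boundary \<Omega>"
    and V: "\<not> affine_dependent V" "card V = DIM('a)"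
    and lo: "\<And>x y. x \<in> convex hull V \<Longrightarrow> y \<in> convex hull V \<Longrightarrow> dist x y \<le> \<sigma> * dist (\<gamma> x) (\<gamma> y)"
    and "\<epsilon> > 0" and q: "q \<in> rel_frontier (convex hull V)" "\<gamma> q \<in> frontier \<Omega>"
  shows "\<not> frontier \<Omega> \<inter> ball (\<gamma> q) \<epsilon> \<subseteq> \<gamma> ` (convex hull V)"
proof
  assume cov: "frontier \<Omega> \<inter> ball (\<gamma> q) \<epsilon> \<subseteq> \<gamma> ` (convex hull V)"
  let ?C = "convex hull V"
  have finV: "finite V" using V(1) by (rule aff_independent_finite)
  have "closed ?C" using finV by (simp add: finite_imp_compact_convex_hull compact_imp_closed)
  then have qC: "q \<in> ?C" "q \<notin> rel_interior ?C" using q(1) by (auto simp: rel_frontier_def)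
  obtain U e and \<phi> :: "'a \<Rightarrow> real" and L where U: "open U" "\<gamma> q \<in> U" "norm e = 1" "L-lipschitz_on UNIV \<phi>"
      "\<Omega> \<inter> U = {y\<in>U. y \<bullet> e < \<phi> (y - (y \<bullet> e) *\<^sub>R e)}"
    using assms(2)[unfolded lipschitz_boundary_def, rule_format, OF q(2)]
    by (elim exE conjE) (rule that; assumption)
  note graph = frontier_Int_eq_graph[OF assms(1) U(1,3,4,5)]
  have ee: "e \<bullet> e = 1" "e \<noteq> 0" using U(3) by (auto simp: dot_square_norm)
  let ?H = "{y. e \<bullet> y = 0}"
  let ?P = "\<lambda>y. y - (y \<bullet> e) *\<^sub>R e"
  let ?f = "\<lambda>p. p + \<phi> p *\<^sub>R e"
  let ?g = "inv_into ?C \<gamma>"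
  define S where "S = ?H \<inter> ?f -` (U \<inter> ball (\<gamma> q) \<epsilon>)"
  have cont: "continuous_on UNIV \<phi>" using U(4) by (rule lipschitz_on_continuous_on)
  have contf: "continuous_on UNIV ?f" by (intro continuous_intros cont)
  have Pf: "?P (?f p) = p" "?f p \<bullet> e = \<phi> p" if "p \<in> ?H" for p
    using that ee by (auto simp: inner_add_right inner_commute)
  have fS: "?f p \<in> \<gamma> ` ?C" if "p \<in> S" for p
  proof -
    have p: "p \<in> ?H" "?f p \<in> U" "?f p \<in> ball (\<gamma> q) \<epsilon>" using that by (auto simp: S_def)
    have "?f p \<bullet> e = \<phi> (?P (?f p))" unfolding Pf(2)[OF p(1)] by simp
    then have "?f p \<in> frontier \<Omega> \<inter> U" unfolding graph using p(2) by (intro CollectI conjI)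
    then have "?f p \<in> frontier \<Omega> \<inter> ball (\<gamma> q) \<epsilon>" using p(3) by (simp only: Int_iff)
    then show ?thesis using cov by (rule subsetD[rotated])
  qed
  have injg: "inj_on \<gamma> ?C" by (rule inj_onI) (use lo in force)
  have glip: "dist (?g u) (?g v) \<le> \<sigma> * dist u v" if "u \<in> \<gamma> ` ?C" "v \<in> \<gamma> ` ?C" for u v
    using lo[of "?g u" "?g v"] that by (simp add: inv_into_into f_inv_into_f)
  have contg: "continuous_on (\<gamma> ` ?C) ?g"
  proof (rule continuous_onI)
    fix u and d :: real assume "u \<in> \<gamma> ` ?C" "d > 0"
    show "\<exists>r>0. \<forall>v\<in>\<gamma> ` ?C. dist v u < r \<longrightarrow> dist (?g v) (?g u) \<le> d"
    \<comment> \<open>No sign of \<sigma> is assumed here; \<open>\<bar>\<sigma>\<bar> + 1\<close>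
      is a positive Lipschitz constant in any case.\<close>
    proof (intro exI[of _ "d / (\<bar>\<sigma>\<bar> + 1)"] conjI ballI impI)
      fix v assume v: "v \<in> \<gamma> ` ?C" "dist v u < d / (\<bar>\<sigma>\<bar> + 1)"
      have "dist (?g v) (?g u) \<le> (\<bar>\<sigma>\<bar> + 1) * dist v u"
        using glip[OF v(1) \<open>u \<in> \<gamma> ` ?C\<close>] by (rule order_trans) (auto intro!: mult_right_mono)
      also have "\<dots> \<le> d" using v(2) by (simp add: field_simps)
      finally show "dist (?g v) (?g u) \<le> d" .
    qed (use \<open>d > 0\<close> in auto)
  qed
  \<comment> \<open>Graph map followed by inverse chart is a continuous injection of a relatively
    open piece of a hyperplane into an affine set of no larger dimension, so its image is relatively
    open. Lying in \<open>?C\<close>, the image falls into the relative interior, yet it contains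
    \<open>q\<close>.\<close>
  have "openin (top_of_set (affine hull ?C)) ((?g \<circ> ?f) ` S)"
  proof (rule invariance_of_domain_affine_sets)
    have "open (?f -` (U \<inter> ball (\<gamma> q) \<epsilon>))" using contf U(1) by (intro open_vimage) auto
    then show "openin (top_of_set ?H) S" unfolding S_def by (rule openin_open_Int)
    show "affine ?H" by (rule affine_hyperplane)
    show "aff_dim (affine hull ?C) \<le> aff_dim ?H"
      using aff_dim_affine_independent[OF V(1)] V(2) ee(2)
      by (simp add: aff_dim_hyperplane affine_hull_convex_hull aff_dim_affine_hull)
    show "continuous_on S (?g \<circ> ?f)"
    proof (rule continuous_on_compose)
      show "continuous_on S ?f" using contf by (rule continuous_on_subset) simp
      show "continuous_on (?f ` S) ?g" using contg by (rule continuous_on_subset) (use fS in auto)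
    qed
    show "?g \<circ> ?f \<in> S \<rightarrow> affine hull ?C"
      unfolding comp_def by (intro Pi_I hull_inc inv_into_into fS)
    show "inj_on (?g \<circ> ?f) S"
    proof (rule comp_inj_on)
      show "inj_on ?f S" by (rule inj_on_inverseI[of _ ?P]) (use Pf(1) in \<open>auto simp: S_def\<close>)
      show "inj_on ?g (?f ` S)" by (rule inj_on_inv_into) (use fS in auto)
    qed
  qed auto
  moreover have "(?g \<circ> ?f) ` S \<subseteq> ?C" using fS by (auto intro: inv_into_into)
  ultimately have sub: "(?g \<circ> ?f) ` S \<subseteq> rel_interior ?C" by (rule rel_interior_maximal[rotated])
  have "\<gamma> q \<in> frontier \<Omega> \<inter> U" using q(2) U(2) by blast
  then have "\<gamma> q \<bullet> e = \<phi> (?P (\<gamma> q))" unfolding graph by blast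
  then have fP: "?f (?P (\<gamma> q)) = \<gamma> q" by (simp flip: \<open>\<gamma> q \<bullet> e = \<phi> (?P (\<gamma> q))\<close>)
  have "?P (\<gamma> q) \<in> S" unfolding S_def vimage_def mem_Collect_eq Int_iff fP using U(2) \<open>\<epsilon> > 0\<close> ee
    by (simp add: inner_diff_right inner_commute)
  moreover have "(?g \<circ> ?f) (?P (\<gamma> q)) = q"
    unfolding comp_apply fP by (rule inv_into_f_f[OF injg qC(1)])
  ultimately have "q \<in> (?g \<circ> ?f) ` S" by (rule rev_image_eqI[OF _ sym])
  then have "q \<in> rel_interior ?C" using sub by (rule subsetD[rotated])
  then show False using qC by simp
qed

section \<open>Simplices\<close>

text \<open>\<open>1 + g (x - a)\<close> is the barycentric coordinate of \<open>a\<close>: it is 1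
  at \<open>a\<close> and 0 on every face without \<open>a\<close>. Affine independence allows
  \<open>g\<close> to be prescribed as -1 on all vectors from \<open>a\<close> to the other
  vertices.\<close>

lemma barycentric_functional:
  fixes V :: "'a::euclidean_space set"
  assumes "\<not> affine_dependent V" "a \<in> V"
  obtains g :: "'a \<Rightarrow> real" where "linear g" "\<And>W x. W \<subseteq> V \<Longrightarrow> a \<notin> W \<Longrightarrow> x \<in> convex hull W \<Longrightarrow> 1 + g (x - a) = 0"
proof -
  have "independent ((\<lambda>x. - a + x) ` (V - {a}))"
    using affine_dependent_iff_dependent2[OF assms(2)] assms(1) by simp
  then obtain g :: "'a \<Rightarrow> real" where g: "linear g" "\<And>x. x \<in> (\<lambda>x. - a + x) ` (V - {a}) \<Longrightarrow> g x = - 1"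
    using linear_independent_extend[of _ "\<lambda>_. - 1"] by blast
  show thesis
  proof (rule that[OF g(1)])
    fix W x assume W: "W \<subseteq> V" "a \<notin> W" and x: "x \<in> convex hull W"
    interpret linear g by (rule g(1))
    have "convex {x. g x = g a - 1}"
    proof (rule convexI)
      fix x y and u v :: real
      assume *: "x \<in> {x. g x = g a - 1}" "y \<in> {x. g x = g a - 1}" "u + v = 1"
      have "g (u *\<^sub>R x + v *\<^sub>R y) = u * g x + v * g y" by (simp add: add scale)
      also have "\<dots> = (u + v) * (g a - 1)" using *(1,2) by (simp only: mem_Collect_eq distrib_right)
      finally show "u *\<^sub>R x + v *\<^sub>R y \<in> {x. g x = g a - 1}" using * by simp
    qed
    moreover have "W \<subseteq> {x. g x = g a - 1}"
    proof
      fix v assume "v \<in> W"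
      then have "g (- a + v) = - 1" using g(2) W by auto
      then show "v \<in> {x. g x = g a - 1}" by (simp add: diff)
    qed
    ultimately have "convex hull W \<subseteq> {x. g x = g a - 1}" by (rule hull_minimal[rotated])
    then show "1 + g (x - a) = 0" using x by (auto simp: diff)
  qed
qed

lemma vertex_in_face:
  fixes V :: "'a::euclidean_space set"
  assumes "\<not> affine_dependent V" "W \<subseteq> V" "a \<in> V" "a \<in> convex hull W"
  shows "a \<in> W"
proof (rule ccontr)
  assume "a \<notin> W"
  obtain g :: "'a \<Rightarrow> real" where "linear g"
      and g: "\<And>W x. W \<subseteq> V \<Longrightarrow> a \<notin> W \<Longrightarrow> x \<in> convex hull W \<Longrightarrow> 1 + g (x - a) = 0"
    using barycentric_functional[OF assms(1,3)] by blast
  have "1 + g (a - a) = 0" by (rule g[OF assms(2) \<open>a \<notin> W\<close> assms(4)])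
  then show False using linear_0[OF \<open>linear g\<close>] by simp
qed

text \<open>A second vertex supplies a facet through \<open>a\<close>; the relative frontier of a
  single point is empty.\<close>

lemma vertex_in_rel_frontier:
  fixes V :: "'a::euclidean_space set"
  assumes "\<not> affine_dependent V" "a \<in> V" "card V \<ge> 2"
  shows "a \<in> rel_frontier (convex hull V)"
proof -
  obtain b where "b \<in> V" "b \<noteq> a"
    using assms(2,3) by (metis card_le_Suc0_iff_eq aff_independent_finite[OF assms(1)] not_less_eq_eq numeral_2_eq_2)
  then have "a \<in> convex hull (V - {b})" using assms(2) by (intro hull_inc) auto
  then show ?thesis unfolding rel_frontier_convex_hull_cases[OF assms(1)] using \<open>b \<in> V\<close> by auto
qed

text \<open>The segment from \<open>z\<close> to \<open>u\<close> never meets the relative frontier,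
  so its part in \<open>C\<close> is closed and, lying in the relative interior, also open in the
  segment. Connectedness leaves only the whole segment.\<close>

lemma rel_ball_subset_simplex:
  fixes C :: "'a::euclidean_space set"
  assumes "closed C" and z: "z \<in> C" and far: "\<And>q. q \<in> rel_frontier C \<Longrightarrow> dist z q \<ge> r"
    and u: "u \<in> affine hull C" "dist z u < r"
  shows "u \<in> C"
proof (rule ccontr)
  assume "u \<notin> C"
  let ?s = "closed_segment z u"
  have sub: "?s \<subseteq> affine hull C"
    using z u(1) by (intro closed_segment_subset affine_imp_convex affine_affine_hull) (auto intro: hull_inc)
  have near: "dist z x < r" if "x \<in> ?s" for x
    using that u(2) segment_bound1[OF that] by (simp add: dist_norm norm_minus_commute)
  then have "?s \<inter> rel_frontier C = {}" using far by fastforce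
  then have eq: "?s \<inter> C = ?s \<inter> rel_interior C"
    using assms(1) rel_interior_subset[of C] by (auto simp: rel_frontier_def)
  obtain T where T: "open T" "rel_interior C = affine hull C \<inter> T"
    using openin_rel_interior[of C] unfolding openin_open by blast
  have "?s \<inter> C = ?s \<inter> T" unfolding eq T(2) using sub by blast
  then have "openin (top_of_set ?s) (?s \<inter> C)" using openin_open_Int[OF T(1)] by metis
  moreover have "closedin (top_of_set ?s) (?s \<inter> C)" using assms(1) by (rule closedin_closed_Int)
  moreover have "connected ?s" by simp
  ultimately have "?s \<inter> C = {} \<or> ?s \<inter> C = ?s" unfolding connected_clopen by blast
  then show False using z \<open>u \<notin> C\<close> by auto
qed

text \<open>The barycentric coordinate of \<open>a\<close> varies between \<open>0\<close> and \<open>1\<close> on an inscribed ball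
  of radius \<open>r\<close>, hence has Lipschitz constant at most \<open>1 / r\<close>.\<close>

lemma barycentric_lipschitz:
  fixes V :: "'a::euclidean_space set"
  assumes V: "\<not> affine_dependent V" and "a \<in> V" and g: "linear g"
    and g0: "\<And>W x. W \<subseteq> V \<Longrightarrow> a \<notin> W \<Longrightarrow> x \<in> convex hull W \<Longrightarrow> 1 + g (x - a) = (0::real)"
    and "r > 0" and z: "z \<in> convex hull V"
    and far: "\<And>q. q \<in> rel_frontier (convex hull V) \<Longrightarrow> dist z q \<ge> r"
    and x: "x \<in> convex hull V" and y: "y \<in> convex hull V"
  shows "r * \<bar>g x - g y\<bar> \<le> dist x y"
proof (cases "x = y")
  case False
  interpret linear g by (rule g)
  have cl: "closed (convex hull V)"
    using aff_independent_finite[OF V] by (simp add: finite_imp_compact_convex_hull compact_imp_closed)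
  have rng: "1 + g (u - a) \<in> {0..1}" if u: "u \<in> convex hull V" for u
  proof -
    have "convex {u. g u \<in> {g a - 1..g a}}"
      using convex_linear_vimage[OF g, of "{g a - 1..g a}"] by (simp only: vimage_def convex_real_interval)
    moreover have "V \<subseteq> {u. g u \<in> {g a - 1..g a}}"
    proof
      fix v assume "v \<in> V"
      show "v \<in> {u. g u \<in> {g a - 1..g a}}"
      proof (cases "v = a")
        case False
        then have "1 + g (v - a) = 0" using g0[of "{v}" v] \<open>v \<in> V\<close> by auto
        then show ?thesis by (simp add: diff)
      qed simp
    qed
    ultimately have "convex hull V \<subseteq> {u. g u \<in> {g a - 1..g a}}" by (rule hull_minimal[rotated])
    then show ?thesis using u by (auto simp: diff)
  qed
  \<comment> \<open>A step of length s from \<open>z\<close> in the direction of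
    \<open>x - y\<close> stays in the simplex and changes the coordinate by s (g x - g y) / dist x
    y. Only the open ball is known to lie in the simplex, so s tends to r afterwards.\<close>
  have "s * \<bar>g x - g y\<bar> \<le> dist x y" if s: "0 < s" "s < r" for s
  proof -
    define u where "u = z + (s / dist x y) *\<^sub>R (x - y)"
    have "u \<in> affine hull (convex hull V)"
      unfolding u_def by (rule mem_affine_3_minus[OF affine_affine_hull hull_inc[OF z] hull_inc[OF x] hull_inc[OF y]])
    moreover have "dist z u = s" using False s by (simp add: u_def dist_norm)
    ultimately have "u \<in> convex hull V"
      using rel_ball_subset_simplex[OF cl z far] s by auto
    then have "\<bar>(1 + g (u - a)) - (1 + g (z - a))\<bar> \<le> 1"
      using rng[of u] rng[OF z] by (auto simp: abs_le_iff)
    also have "(1 + g (u - a)) - (1 + g (z - a)) = s / dist x y * (g x - g y)"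
      by (simp add: u_def diff add scale)
    finally have "s / dist x y * \<bar>g x - g y\<bar> \<le> 1" using s by (simp add: abs_mult)
    then show ?thesis using False s by (simp add: divide_le_eq)
  qed
  then have ev: "\<forall>\<^sub>F s in at_left r. s * \<bar>g x - g y\<bar> \<le> dist x y"
    using eventually_at_left_field[of _ r] \<open>r > 0\<close> by blast
  have "((\<lambda>s. s * \<bar>g x - g y\<bar>) \<longlongrightarrow> r * \<bar>g x - g y\<bar>) (at_left r)"
    by (intro tendsto_intros)
  then show ?thesis using ev by (rule tendsto_upperbound) simp
qed simp

section \<open>Geodesic distance\<close>

text \<open>All that is kept of a curve is that its image is connected and stays within
  \<open>D\<close> of its start. The latter follows by testing the length with the partition
  \<open>[0, u]\<close>.\<close>

lemma short_connection:
  fixes S :: "'a::euclidean_space set"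
  assumes "geodesic_dist S x y < ennreal D"
  shows "\<exists>C. connected C \<and> C \<subseteq> S \<and> x \<in> C \<and> y \<in> C \<and> (\<forall>z\<in>C. dist x z \<le> D)"
proof -
  obtain g where g: "path g" "path_image g \<subseteq> S" "pathstart g = x" "pathfinish g = y" "curve_length g < ennreal D"
    using assms unfolding geodesic_dist_def INF_less_iff by blast
  have "dist x z \<le> D" if z: "z \<in> path_image g" for z
  proof -
    obtain u where u: "u \<in> {0..1}" "z = g u" using z by (auto simp: path_image_def)
    have "ennreal (dist x z) = (\<Sum>i<length [0, u] - 1. ennreal (dist (g ([0, u] ! i)) (g ([0, u] ! Suc i))))"
      using g(3) u by (simp add: pathstart_def)
    also have "\<dots> \<le> curve_length g"
      unfolding curve_length_def by (rule SUP_upper) (use u in auto)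
    also have "\<dots> \<le> ennreal D" using g(5) by simp
    finally have "ennreal (dist x z) \<le> ennreal D" .
    moreover have "0 < ennreal D" using g(5) by (rule order_le_less_trans[OF zero_le])
    ultimately show ?thesis by (simp add: ennreal_le_iff)
  qed
  then show ?thesis
    using g connected_path_image[OF g(1)] pathstart_in_path_image[of g] pathfinish_in_path_image[of g]
    by (intro exI[of _ "path_image g"]) auto
qed

section \<open>Separation of disjoint elements\<close>

text \<open>The radius of the ball found in each flat simplex is h divided by this number: an
  element has diameter at least h / \<kappa>, hence contains a geodesic ball of radius above h / (4
  \<kappa> \<sigma>); Euclidean balls cost a factor K, and the chart costs another \<sigma>.\<close>

definition barycentric_const :: "real \<Rightarrow> real \<Rightarrow> real \<Rightarrow> real" where
  "barycentric_const K \<sigma> \<kappa> = 4 * \<kappa> * \<sigma>\<^sup>2 * K"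

text \<open>With M the barycentric constant, 1 / (M \<sigma> K) is the gap, in units of h, between a
  node and an element without it. The last factor is 2 m + 2, where m = M \<kappa> \<sigma>^3 comes
  from \<open>edge_estimate\<close> and accounts for a detour through a node; the second K comes
  from the connecting curve.\<close>

definition separation_const :: "real \<Rightarrow> real \<Rightarrow> real \<Rightarrow> real" where
  "separation_const K \<sigma> \<kappa> = 1 / (barycentric_const K \<sigma> \<kappa> * \<sigma> * K\<^sup>2
      * (2 * (barycentric_const K \<sigma> \<kappa> * \<kappa> * \<sigma> ^ 3) + 2))"

lemma barycentric_const_pos: "\<sigma> > 0 \<Longrightarrow> \<kappa> > 0 \<Longrightarrow> K > 0 \<Longrightarrow> barycentric_const K \<sigma> \<kappa> > 0"
  by (simp add: barycentric_const_def)

lemma separation_const_pos: "\<sigma> > 0 \<Longrightarrow> \<kappa> > 0 \<Longrightarrow> K > 0 \<Longrightarrow> separation_const K \<sigma> \<kappa> > 0"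
  using barycentric_const_pos[of \<sigma> \<kappa> K]
  by (auto simp: separation_const_def intro!: divide_pos_pos mult_pos_pos add_nonneg_pos)

text \<open>The constants above are functions of \<open>K\<close>, \<sigma> and \<kappa> defined
  outside the locale, so that their independence of \<open>h\<close> and \<open>\<T>\<close> is
  visible.\<close>

locale boundary_mesh =
  fixes \<Omega> \<Gamma> :: "'a::euclidean_space set" and K \<sigma> \<kappa> h :: real and \<T> :: "'a element set"
  assumes open_domain: "open \<Omega>" and bounded_domain: "bounded \<Omega>"
    and lipschitz: "lipschitz_boundary \<Omega>" and Gamma_eq: "\<Gamma> = frontier \<Omega>"
    and K_pos: "K > 0"
    and geodesic: "x \<in> \<Gamma> \<Longrightarrow> y \<in> \<Gamma> \<Longrightarrow> geodesic_dist \<Gamma> x y \<le> ennreal (K * dist x y)"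
    and pos: "\<sigma> > 0" "\<kappa> > 0" "h > 0"
    and mesh: "surface_mesh \<Gamma> \<T>" and quasi_uniform: "quasi_uniform \<kappa> h \<T>"
    and shape_regular: "shape_regular \<Gamma> \<sigma> \<T>"
    and dim: "DIM('a) = 2 \<or> DIM('a) = 3"
begin

abbreviation M :: real where "M \<equiv> barycentric_const K \<sigma> \<kappa>"

lemma M_pos: "M > 0" using pos(1,2) K_pos by (rule barycentric_const_pos)

lemma simplex:
  assumes "(V, \<gamma>) \<in> \<T>"
  shows "finite V" "card V = DIM('a)" "\<not> affine_dependent V"
  using mesh assms unfolding surface_mesh_def curvilinear_simplex_def by force+

lemma chart_upper: "(V, \<gamma>) \<in> \<T> \<Longrightarrow> x \<in> convex hull V \<Longrightarrow> y \<in> convex hull V \<Longrightarrow> dist (\<gamma> x) (\<gamma> y) \<le> \<sigma> * dist x y"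
  and chart_lower: "(V, \<gamma>) \<in> \<T> \<Longrightarrow> x \<in> convex hull V \<Longrightarrow> y \<in> convex hull V \<Longrightarrow> dist x y \<le> \<sigma> * dist (\<gamma> x) (\<gamma> y)"
  using bspec[OF shape_regular[unfolded shape_regular_def], of "(V, \<gamma>)", simplified] by simp_all

lemma chart_inj: "(V, \<gamma>) \<in> \<T> \<Longrightarrow> inj_on \<gamma> (convex hull V)"
  by (rule inj_onI) (use chart_lower in force)

lemma body_eq: "elem_body (V, \<gamma>) = \<gamma> ` (convex hull V)"
  by (simp add: elem_body_def)

lemma body_subset: "E \<in> \<T> \<Longrightarrow> elem_body E \<subseteq> \<Gamma>"
  using mesh by (auto simp: surface_mesh_def)

lemma compact_body:
  assumes "E \<in> \<T>" shows "compact (elem_body E)"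
proof -
  obtain V \<gamma> where E: "E = (V, \<gamma>)" by force
  have "\<sigma>-lipschitz_on (convex hull V) \<gamma>"
    using chart_upper assms pos by (intro lipschitz_onI) (auto simp: E)
  then have "compact (\<gamma> ` (convex hull V))"
    using simplex(1) assms E by (intro compact_continuous_image lipschitz_on_continuous_on) (auto simp: finite_imp_compact_convex_hull)
  then show ?thesis by (simp add: E body_eq)
qed

lemma dist_body:
  assumes "E \<in> \<T>" "x \<in> elem_body E" "y \<in> elem_body E"
  shows "dist x y \<le> \<kappa> * h"
  using diameter_bounded_bound[OF compact_imp_bounded[OF compact_body] assms(2,3)] assms(1)
    quasi_uniform unfolding quasi_uniform_def by fastforce

text \<open>A geodesic ball inside the element contains all points of \<Gamma> within Euclidean
  distance \<rho> of its centre. A relative frontier point mapped closer than \<rho> would have a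
  whole neighbourhood in \<Gamma> covered by the element, against
  \<open>rel_frontier_not_covered\<close>. The chart carries this gap back to the simplex.\<close>

lemma inscribed_ball:
  assumes E: "(V, \<gamma>) \<in> \<T>"
  shows "\<exists>z\<in>convex hull V. \<forall>q\<in>rel_frontier (convex hull V). h / M \<le> dist z q"
proof -
  let ?T = "elem_body (V, \<gamma>)"
  \<comment> \<open>The supremum need not be attained; the factor 2 makes the inequality strict, so
    that some ball exceeds the bound.\<close>
  have "ennreal (h / (2 * \<kappa> * \<sigma>)) < inscribed_diameter \<Gamma> ?T"
  proof (rule ccontr)
    assume "\<not> ?thesis"
    then have "ennreal \<sigma> * inscribed_diameter \<Gamma> ?T \<le> ennreal \<sigma> * ennreal (h / (2 * \<kappa> * \<sigma>))"
      by (intro mult_left_mono) auto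
    also have "\<dots> = ennreal (h / (2 * \<kappa>))" using pos by (simp add: ennreal_mult[symmetric])
    finally have "ennreal (diameter ?T) \<le> ennreal (h / (2 * \<kappa>))"
      using shape_regular E unfolding shape_regular_def by (force intro: order_trans)
    then have "diameter ?T \<le> h / (2 * \<kappa>)" using pos by (simp add: ennreal_le_iff)
    moreover have "h / \<kappa> \<le> diameter ?T"
      using quasi_uniform E pos unfolding quasi_uniform_def by (force simp: field_simps)
    moreover have "h / (2 * \<kappa>) < h / \<kappa>" using pos by (simp add: field_simps)
    ultimately show False by linarith
  qed
  then obtain z r where z: "z \<in> ?T" "0 < r" "{x\<in>\<Gamma>. geodesic_dist \<Gamma> z x < ennreal r} \<subseteq> ?T"
     and r: "ennreal (h / (2 * \<kappa> * \<sigma>)) < ennreal (2 * r)"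
    unfolding inscribed_diameter_def less_SUP_iff by auto
  have r2: "h / (4 * \<kappa> * \<sigma>) < r" using r pos z(2) by (simp add: ennreal_less_iff field_simps)
  define \<rho> where "\<rho> = h / (4 * \<kappa> * \<sigma> * K)"
  have \<rho>: "\<rho> > 0" "K * \<rho> < r" using pos K_pos r2 by (auto simp: \<rho>_def field_simps)
  have zG: "z \<in> \<Gamma>" using z(1) body_subset[OF E] by auto
  have cov: "\<Gamma> \<inter> ball z \<rho> \<subseteq> ?T"
  proof
    fix x assume x: "x \<in> \<Gamma> \<inter> ball z \<rho>"
    have "geodesic_dist \<Gamma> z x \<le> ennreal (K * dist z x)" using geodesic zG x by auto
    also have "\<dots> \<le> ennreal (K * \<rho>)" using x K_pos by (intro ennreal_leI mult_left_mono) auto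
    also have "\<dots> < ennreal r" using \<rho> K_pos z(2) by (subst ennreal_less_iff) auto
    finally show "x \<in> ?T" using z(3) x by auto
  qed
  obtain z' where z': "z' \<in> convex hull V" "z = \<gamma> z'" using z(1) by (auto simp: body_eq)
  show ?thesis
  proof (intro bexI[OF _ z'(1)] ballI)
    fix q assume q: "q \<in> rel_frontier (convex hull V)"
    have "closed (convex hull V)" using simplex(1)[OF E] by (simp add: finite_imp_compact_convex_hull compact_imp_closed)
    then have qC: "q \<in> convex hull V" using q by (auto simp: rel_frontier_def)
    have qG: "\<gamma> q \<in> \<Gamma>" using qC body_subset[OF E] by (auto simp: body_eq)
    have "\<rho> \<le> dist z (\<gamma> q)"
    proof (rule ccontr)
      assume "\<not> \<rho> \<le> dist z (\<gamma> q)"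
      then have "0 < \<rho> - dist z (\<gamma> q)" by simp
      moreover have "\<Gamma> \<inter> ball (\<gamma> q) (\<rho> - dist z (\<gamma> q)) \<subseteq> \<gamma> ` (convex hull V)"
      proof
        fix x assume x: "x \<in> \<Gamma> \<inter> ball (\<gamma> q) (\<rho> - dist z (\<gamma> q))"
        have "dist z x \<le> dist z (\<gamma> q) + dist (\<gamma> q) x" by (rule dist_triangle)
        then show "x \<in> \<gamma> ` (convex hull V)" using cov x by (auto simp: body_eq)
      qed
      ultimately show False
        using rel_frontier_not_covered[OF open_domain lipschitz simplex(3,2)[OF E] chart_lower[OF E] _ q, of "\<rho> - dist z (\<gamma> q)"]
          qG unfolding Gamma_eq by blast
    qed
    also have "\<dots> \<le> \<sigma> * dist z' q" using chart_upper[OF E z'(1) qC] z'(2) by simp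
    finally have "\<rho> / \<sigma> \<le> dist z' q" using pos by (simp add: field_simps)
    moreover have "\<rho> / \<sigma> = h / M" by (simp add: \<rho>_def barycentric_const_def power2_eq_square mult_ac)
    ultimately show "h / M \<le> dist z' q" by simp
  qed
qed

lemma coordinate:
  assumes E: "(V, \<gamma>) \<in> \<T>" and "a \<in> V"
  obtains g :: "'a \<Rightarrow> real" where "linear g" "\<And>W x. W \<subseteq> V \<Longrightarrow> a \<notin> W \<Longrightarrow> x \<in> convex hull W \<Longrightarrow> 1 + g (x - a) = 0"
    "\<And>x y. x \<in> convex hull V \<Longrightarrow> y \<in> convex hull V \<Longrightarrow> h / M * \<bar>g x - g y\<bar> \<le> dist x y"
proof -
  obtain g :: "'a \<Rightarrow> real" where g: "linear g" "\<And>W x. W \<subseteq> V \<Longrightarrow> a \<notin> W \<Longrightarrow> x \<in> convex hull W \<Longrightarrow> 1 + g (x - a) = 0"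
    using barycentric_functional[OF simplex(3)[OF E] assms(2)] by blast
  obtain z where z: "z \<in> convex hull V" "\<And>q. q \<in> rel_frontier (convex hull V) \<Longrightarrow> h / M \<le> dist z q"
    using inscribed_ball[OF E] by blast
  have "h / M > 0" using pos M_pos by simp
  show thesis
    by (rule that[OF g]) (assumption | rule barycentric_lipschitz[OF simplex(3)[OF E] assms(2) g \<open>h / M > 0\<close> z])+
qed

text \<open>The coordinate of \<open>a\<close> falls from 1 at \<open>a\<close> to 0 at
  \<open>x\<close>, and its Lipschitz constant is at most M / h.\<close>

lemma vertex_opposite:
  assumes E: "(V, \<gamma>) \<in> \<T>" and a: "a \<in> V" "W \<subseteq> V" "a \<notin> W" "x \<in> convex hull W"
  shows "h / (M * \<sigma>) \<le> dist (\<gamma> a) (\<gamma> x)"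
proof -
  obtain g :: "'a \<Rightarrow> real" where g: "linear g" "\<And>W x. W \<subseteq> V \<Longrightarrow> a \<notin> W \<Longrightarrow> x \<in> convex hull W \<Longrightarrow> 1 + g (x - a) = 0"
    "\<And>x y. x \<in> convex hull V \<Longrightarrow> y \<in> convex hull V \<Longrightarrow> h / M * \<bar>g x - g y\<bar> \<le> dist x y"
    using coordinate[OF E a(1)] by blast
  have hull: "a \<in> convex hull V" "x \<in> convex hull V" using a hull_mono[OF a(2)] by (auto intro: hull_inc)
  have "g a - g x = 1" using g(2)[OF a(2-4)] by (simp add: linear_diff[OF g(1)])
  then have "h / M \<le> dist a x" using g(3)[OF hull] by simp
  also have "\<dots> \<le> \<sigma> * dist (\<gamma> a) (\<gamma> x)" using chart_lower[OF E hull] .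
  finally show ?thesis using pos M_pos by (simp add: field_simps)
qed

text \<open>This is the minimal angle condition in quantitative form. For \<open>p\<close> at
  parameter t on the edge, the coordinate of \<open>a\<close> is 1 - t at \<open>p\<close> and 0 at
  \<open>x\<close>, so 1 - t is at most of order dist / h, while the distance from \<open>p\<close>
  to \<open>b\<close> is 1 - t times an edge length of order h; the powers of h cancel.\<close>

lemma edge_estimate:
  assumes E: "(V, \<gamma>) \<in> \<T>" and a: "a \<in> V" "b \<in> V" "p \<in> convex hull {a, b}"
    and W: "W \<subseteq> V" "a \<notin> W" "x \<in> convex hull W"
  shows "dist (\<gamma> p) (\<gamma> b) \<le> M * \<kappa> * \<sigma> ^ 3 * dist (\<gamma> p) (\<gamma> x)"
proof (cases "a = b")
  case True
  then show ?thesis using a(3) M_pos pos by simp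
next
  case False
  obtain g :: "'a \<Rightarrow> real" where g: "linear g" "\<And>W x. W \<subseteq> V \<Longrightarrow> a \<notin> W \<Longrightarrow> x \<in> convex hull W \<Longrightarrow> 1 + g (x - a) = 0"
    "\<And>x y. x \<in> convex hull V \<Longrightarrow> y \<in> convex hull V \<Longrightarrow> h / M * \<bar>g x - g y\<bar> \<le> dist x y"
    using coordinate[OF E a(1)] by blast
  have "{a, b} \<subseteq> V" using a by simp
  then have hull: "a \<in> convex hull V" "b \<in> convex hull V" "p \<in> convex hull V" "x \<in> convex hull V"
    using a W(3) hull_mono[OF W(1)] hull_mono[of "{a, b}" V convex] by (auto intro: hull_inc)
  obtain t where t: "0 \<le> t" "t \<le> 1" "p = (1 - t) *\<^sub>R a + t *\<^sub>R b"
    using a(3) by (auto simp: segment_convex_hull[symmetric] in_segment)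
  have gx: "g x = g a - 1" using g(2)[OF W] by (simp add: linear_diff[OF g(1)])
  have gb: "g b = g a - 1" using g(2)[of "{b}" b] a False by (simp add: linear_diff[OF g(1)])
  have "g p = (1 - t) * g a + t * g b" unfolding t(3) by (simp add: linear_add[OF g(1)] linear_scale[OF g(1)])
  then have "g p - g x = 1 - t" unfolding gb gx by (simp add: algebra_simps)
  then have "h / M * (1 - t) \<le> dist p x" using g(3)[OF hull(3,4)] t by simp
  also have "\<dots> \<le> \<sigma> * dist (\<gamma> p) (\<gamma> x)" using chart_lower[OF E hull(3,4)] .
  finally have 1: "1 - t \<le> M * \<sigma> * dist (\<gamma> p) (\<gamma> x) / h" using pos M_pos by (simp add: field_simps)
  have "p - b = (1 - t) *\<^sub>R (a - b)" unfolding t(3) by (simp add: algebra_simps)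
  then have pb: "dist p b = (1 - t) * dist a b" using t by (simp add: dist_norm)
  have "dist a b \<le> \<sigma> * dist (\<gamma> a) (\<gamma> b)" using chart_lower[OF E hull(1,2)] .
  also have "\<dots> \<le> \<sigma> * (\<kappa> * h)"
    using dist_body[OF E, of "\<gamma> a" "\<gamma> b"] hull pos by (intro mult_left_mono) (auto simp: body_eq)
  finally have 2: "dist a b \<le> \<sigma> * (\<kappa> * h)" .
  have "dist (\<gamma> p) (\<gamma> b) \<le> \<sigma> * dist p b" using chart_upper[OF E hull(3,2)] .
  also have "\<dots> \<le> \<sigma> * ((M * \<sigma> * dist (\<gamma> p) (\<gamma> x) / h) * (\<sigma> * (\<kappa> * h)))"
    unfolding pb using 1 2 t pos M_pos by (intro mult_left_mono mult_mono) auto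
  also have "\<dots> = M * \<kappa> * \<sigma> ^ 3 * dist (\<gamma> p) (\<gamma> x)"
    using pos by (simp add: power3_eq_cube)
  finally show ?thesis .
qed

section \<open>Vertices and common faces of a conforming mesh\<close>

lemma conforming:
  assumes "E \<in> \<T>" "F \<in> \<T>" "E \<noteq> F"
  obtains W X where "W \<subset> fst E" "X \<subset> fst F" "snd E ` W = snd F ` X"
    "elem_body E \<inter> elem_body F = snd E ` (convex hull W)"
    "elem_body E \<inter> elem_body F = snd F ` (convex hull X)"
proof -
  have "conforming_pair E F" using mesh assms by (simp add: surface_mesh_def)
  then show thesis unfolding conforming_pair_def by (elim exE conjE) (rule that)
qed

lemma vertex_subset_body: "elem_vertices E \<subseteq> elem_body E"
  by (auto simp: elem_vertices_def elem_body_def intro: hull_inc)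

lemma vertex_in_common_face:
  assumes E: "E \<in> \<T>" and W: "W \<subset> fst E" "a \<in> elem_vertices E" "a \<in> snd E ` (convex hull W)"
  shows "a \<in> snd E ` W"
proof -
  obtain V \<gamma> where [simp]: "E = (V, \<gamma>)" by force
  have E': "(V, \<gamma>) \<in> \<T>" using E by simp
  obtain v where v: "v \<in> V" "a = \<gamma> v" using W(2) by (auto simp: elem_vertices_def)
  obtain w where w: "w \<in> convex hull W" "a = \<gamma> w" using W(3) by auto
  have "w \<in> convex hull V" using w hull_mono[of W V convex] W by auto
  then have "v = w" using chart_inj[OF E'] v w hull_inc[of v V convex] by (auto dest: inj_onD)
  then have "v \<in> W" using vertex_in_face[OF simplex(3)[OF E'], of W v] v w W by auto
  then show ?thesis using v by simp
qed

text \<open>Absence of hanging nodes: a vertex of \<open>E\<close> lying in the common face with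
  \<open>F\<close> is a vertex of that face, and the face has the same vertices in both
  elements.\<close>

lemma node_in_body:
  assumes "a \<in> mesh_nodes \<T>" "F \<in> \<T>" "a \<in> elem_body F"
  shows "a \<in> elem_vertices F"
proof -
  obtain E where E: "E \<in> \<T>" "a \<in> elem_vertices E" using assms(1) by (auto simp: mesh_nodes_def)
  show ?thesis
  proof (cases "E = F")
    case False
    obtain W X where W: "W \<subset> fst E" "X \<subset> fst F" "snd E ` W = snd F ` X"
        "elem_body E \<inter> elem_body F = snd E ` (convex hull W)"
      by (rule conforming[OF E(1) assms(2) False])
    have "a \<in> snd E ` (convex hull W)" using W(4) assms(3) E(2) vertex_subset_body[of E] by blast
    then have "a \<in> snd E ` W" by (rule vertex_in_common_face[OF E(1) W(1) E(2)])
    then show ?thesis using W(2,3) unfolding elem_vertices_def by blast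
  qed (use E in simp)
qed

lemma vertex_is_node: "E \<in> \<T> \<Longrightarrow> a \<in> elem_vertices E \<Longrightarrow> a \<in> mesh_nodes \<T>"
  by (auto simp: mesh_nodes_def)

text \<open>For a node, being a vertex of an element, lying on its boundary and lying in its body
  coincide, so patches can be treated combinatorially.\<close>

lemma patch_eq:
  assumes "a \<in> mesh_nodes \<T>"
  shows "patch \<T> a = (\<Union>E\<in>{E\<in>\<T>. a \<in> elem_vertices E}. elem_body E)"
proof -
  have "a \<in> elem_boundary E \<longleftrightarrow> a \<in> elem_vertices E" if "E \<in> \<T>" for E
  proof -
    obtain V \<gamma> where E: "E = (V, \<gamma>)" by force
    have "(V, \<gamma>) \<in> \<T>" using that E by simp
    note s = simplex[OF this]
    have "closed (convex hull V)" using s(1) by (simp add: finite_imp_compact_convex_hull compact_imp_closed)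
    then have "rel_frontier (convex hull V) \<subseteq> convex hull V" by (auto simp: rel_frontier_def)
    then have "elem_boundary E \<subseteq> elem_body E" by (auto simp: E elem_boundary_def elem_body_def)
    moreover have "elem_vertices E \<subseteq> elem_boundary E"
      using vertex_in_rel_frontier[OF s(3)] s(2) dim by (auto simp: E elem_boundary_def elem_vertices_def)
    ultimately show ?thesis using node_in_body[OF assms that] by auto
  qed
  then show ?thesis unfolding patch_def by (intro arg_cong[where f = Union] image_cong) auto
qed

lemma common_vertex:
  assumes "E \<in> \<T>" "F \<in> \<T>" "elem_body E \<inter> elem_body F \<noteq> {}"
  shows "\<exists>a. a \<in> elem_vertices E \<and> a \<in> elem_vertices F"
proof (cases "E = F")
  case True
  have "fst E \<noteq> {}" using simplex(2)[of "fst E" "snd E"] assms(1) dim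
    by (metis card.empty prod.collapse zero_neq_numeral)
  then show ?thesis using True by (auto simp: elem_vertices_def)
next
  case False
  obtain W X where W: "W \<subset> fst E" "X \<subset> fst F" "snd E ` W = snd F ` X"
        "elem_body E \<inter> elem_body F = snd E ` (convex hull W)"
    by (rule conforming[OF assms(1,2) False])
  then have "W \<noteq> {}" using assms(3) by auto
  then obtain w where w: "w \<in> W" by auto
  then have "snd E w \<in> snd E ` fst E" using W(1) by auto
  moreover have "snd E w \<in> snd F ` fst F" using w W(2,3) by blast
  ultimately show ?thesis unfolding elem_vertices_def by blast
qed

section \<open>Crossing the mesh along connected sets\<close>

text \<open>The bodies in \<open>\<S>\<close> and the remaining bodies form two closed sets that
  cover the connected set \<open>C\<close>, so they meet on \<open>C\<close>. This stands in for the
  moment at which a curve leaves a family of elements.\<close>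

lemma crossing_point:
  assumes "connected C" "C \<subseteq> \<Gamma>" "\<S> \<subseteq> \<T>"
    and "C \<inter> (\<Union>E\<in>\<S>. elem_body E) \<noteq> {}" "C \<inter> (\<Union>E\<in>\<T> - \<S>. elem_body E) \<noteq> {}"
  obtains x G H where "x \<in> C" "G \<in> \<S>" "H \<in> \<T> - \<S>" "x \<in> elem_body G" "x \<in> elem_body H"
proof -
  have fin: "finite \<T>" using mesh by (simp add: surface_mesh_def)
  have cl: "closed (\<Union>E\<in>\<R>. elem_body E)" if "\<R> \<subseteq> \<T>" for \<R>
    using finite_subset[OF that fin] that by (intro closed_UN ballI) (blast intro: compact_imp_closed compact_body)+
  have "C \<subseteq> (\<Union>E\<in>\<S>. elem_body E) \<union> (\<Union>E\<in>\<T> - \<S>. elem_body E)"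
  proof -
    have "\<Gamma> = (\<Union>E\<in>\<T>. elem_body E)" using mesh by (simp add: surface_mesh_def)
    then show ?thesis using assms(2) by blast
  qed
  then have "(\<Union>E\<in>\<S>. elem_body E) \<inter> (\<Union>E\<in>\<T> - \<S>. elem_body E) \<inter> C \<noteq> {}"
    using connected_closedD[OF assms(1) _ _ cl[OF assms(3)] cl[OF Diff_subset]] assms(4,5)
    by (metis Int_commute)
  then show thesis using that by blast
qed

text \<open>The geodesic distance is an infimum, so a connection is available only for
  \<open>D\<close> strictly above \<open>K * dist x y\<close>. The slack is removed later by
  \<open>dense_ge\<close>.\<close>

lemma connection:
  assumes "x \<in> \<Gamma>" "y \<in> \<Gamma>" "K * dist x y < D"
  shows "\<exists>C. connected C \<and> C \<subseteq> \<Gamma> \<and> x \<in> C \<and> y \<in> C \<and> (\<forall>z\<in>C. dist x z \<le> D)"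
proof (rule short_connection)
  have "geodesic_dist \<Gamma> x y \<le> ennreal (K * dist x y)" using geodesic assms by auto
  also have "\<dots> < ennreal D" using assms(3) K_pos by (subst ennreal_less_iff) auto
  finally show "geodesic_dist \<Gamma> x y < ennreal D" .
qed

text \<open>A connection from \<open>a\<close> to \<open>s\<close> has to leave the star of
  \<open>a\<close>. It does so in a face shared with an element that does not have \<open>a\<close>
  as a vertex, so \<open>a\<close> is no vertex of that face and \<open>vertex_opposite\<close>
  applies.\<close>

lemma node_star_separation:
  assumes a: "a \<in> mesh_nodes \<T>" and H: "H \<in> \<T>" "a \<notin> elem_vertices H" and s: "s \<in> elem_body H"
  shows "h / (M * \<sigma> * K) \<le> dist a s"
proof -
  obtain E where E: "E \<in> \<T>" "a \<in> elem_vertices E" using a by (auto simp: mesh_nodes_def)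
  have G: "a \<in> \<Gamma>" "s \<in> \<Gamma>" using E H s vertex_subset_body body_subset by blast+
  have "h / (M * \<sigma>) \<le> D" if D: "K * dist a s < D" for D
  proof -
    obtain C where C: "connected C" "C \<subseteq> \<Gamma>" "a \<in> C" "s \<in> C" "\<And>z. z \<in> C \<Longrightarrow> dist a z \<le> D"
      using connection[OF G D] by blast
    let ?S = "{E\<in>\<T>. a \<in> elem_vertices E}"
    obtain x F F' where x: "x \<in> C" "F \<in> ?S" "F' \<in> \<T> - ?S" "x \<in> elem_body F" "x \<in> elem_body F'"
    proof (rule crossing_point[OF C(1,2), of ?S])
      show "C \<inter> (\<Union>E\<in>?S. elem_body E) \<noteq> {}" using E C(3) vertex_subset_body by blast
      show "C \<inter> (\<Union>E\<in>\<T> - ?S. elem_body E) \<noteq> {}" using H s C(4) by blast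
    qed auto
    obtain V \<gamma> where F: "F = (V, \<gamma>)" by force
    have F1: "(V, \<gamma>) \<in> \<T>" "F \<in> \<T>" "F' \<in> \<T>" "F \<noteq> F'" using x F by auto
    obtain W X where W: "W \<subset> fst F" "X \<subset> fst F'" "snd F ` W = snd F' ` X"
        "elem_body F \<inter> elem_body F' = snd F ` (convex hull W)"
      by (rule conforming[OF F1(2,3,4)])
    obtain x' where x': "x' \<in> convex hull W" "x = \<gamma> x'" using W(4) x(4,5) F by auto
    obtain a' where a': "a' \<in> V" "a = \<gamma> a'" using x(2) F by (auto simp: elem_vertices_def)
    have "a' \<notin> W"
    proof
      assume "a' \<in> W"
      then have "a \<in> snd F' ` X" using a' W(3) F by force
      then show False using W(2) x(3) by (auto simp: elem_vertices_def)
    qed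
    then have "h / (M * \<sigma>) \<le> dist a x" 
      using vertex_opposite[OF F1(1) a'(1) _ _ x'(1)] W(1) F a' x' by auto
    also have "\<dots> \<le> D" using C(5) x(1) by auto
    finally show ?thesis .
  qed
  then have "h / (M * \<sigma>) \<le> K * dist a s" by (rule dense_ge)
  then show ?thesis using pos K_pos M_pos by (simp add: field_simps)
qed

text \<open>If \<open>p\<close> is a point where a short connection from \<open>E\<close> to \<open>F\<close> leaves \<open>E\<close>, then \<open>p\<close> is close to a
  vertex of \<open>E\<close>: either \<open>p\<close> is itself a vertex, or the connection also has to leave the star of the
  edge through \<open>p\<close>. Faces being at most one-dimensional, these are all cases.\<close>

lemma close_to_vertex:
  assumes E: "E \<in> \<T>" and G: "G \<in> \<T>" "E \<noteq> G" and F: "F \<in> \<T>" "elem_body E \<inter> elem_body F = {}"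
    and C: "connected C" "C \<subseteq> \<Gamma>" "p \<in> C" "s \<in> C" "\<And>x. x \<in> C \<Longrightarrow> dist p x \<le> D"
    and p: "p \<in> elem_body E" "p \<in> elem_body G" and s: "s \<in> elem_body F"
  shows "\<exists>b\<in>elem_vertices E. dist p b \<le> M * \<kappa> * \<sigma> ^ 3 * D"
proof -
  have Mpos: "M * \<kappa> * \<sigma> ^ 3 \<ge> 0" using M_pos pos by simp
  have D0: "D \<ge> 0" using C(5)[OF C(3)] by simp
  obtain V \<gamma> where E': "E = (V, \<gamma>)" by force
  obtain W X where WX: "W \<subset> fst E" "X \<subset> fst G" "snd E ` W = snd G ` X"
      "elem_body E \<inter> elem_body G = snd E ` (convex hull W)" "elem_body E \<inter> elem_body G = snd G ` (convex hull X)"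
    by (rule conforming[OF E G])
  then have W: "W \<subset> V" "elem_body E \<inter> elem_body G = \<gamma> ` (convex hull W)" using E' by simp_all
  have finW: "finite W" using W(1) simplex(1)[of V \<gamma>] E E' by (metis finite_subset psubset_imp_subset)
  have "card W < card V" using W(1) simplex(1)[of V \<gamma>] E E' by (metis psubset_card_mono)
  then have cW: "card W \<le> 2" using simplex(2)[of V \<gamma>] E E' dim by auto
  obtain p' where p': "p' \<in> convex hull W" "p = \<gamma> p'" using W(2) p by auto
  then have "W \<noteq> {}" by auto
  then have "card W = 1 \<or> card W = 2" using cW finW by (auto simp: le_Suc_eq numeral_2_eq_2 card_eq_0_iff)
  then show ?thesis
  proof
    assume "card W = 1"
    then obtain b where "W = {b}" by (auto simp: card_1_singleton_iff)
    then have "p = \<gamma> b" "b \<in> V" using p' W(1) by auto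
    then show ?thesis using E' D0 Mpos by (intro bexI[of _ p]) (auto simp: elem_vertices_def)
  next
    assume "card W = 2"
    then obtain a b where ab: "W = {a, b}" "a \<noteq> b" by (auto simp: card_2_iff)
    then have abV: "a \<in> V" "b \<in> V" using W(1) by auto
    \<comment> \<open>This is the star of the edge. It excludes \<open>F\<close>, which would
      otherwise share a node with \<open>E\<close>, so the connection has to leave it.\<close>
    let ?S = "{H\<in>\<T>. \<gamma> a \<in> elem_vertices H \<and> \<gamma> b \<in> elem_vertices H}"
    have ES: "E \<in> ?S" using E abV E' by (auto simp: elem_vertices_def)
    have "F \<notin> ?S"
    proof
      assume "F \<in> ?S"
      then have "\<gamma> a \<in> elem_body E \<inter> elem_body F" using ES vertex_subset_body by blast
      then show False using F(2) by auto
    qed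
    obtain x H H' where x: "x \<in> C" "H \<in> ?S" "H' \<in> \<T> - ?S" "x \<in> elem_body H" "x \<in> elem_body H'"
    proof (rule crossing_point[OF C(1,2), of ?S])
      show "C \<inter> (\<Union>E\<in>?S. elem_body E) \<noteq> {}" using ES p C(3) by blast
      show "C \<inter> (\<Union>E\<in>\<T> - ?S. elem_body E) \<noteq> {}" using F \<open>F \<notin> ?S\<close> s C(4) by blast
    qed auto
    obtain U \<psi> where H: "H = (U, \<psi>)" by force
    have H1: "(U, \<psi>) \<in> \<T>" "H \<in> \<T>" "H' \<in> \<T>" "H \<noteq> H'" using x H by auto
    obtain a' b' where a': "a' \<in> U" "\<gamma> a = \<psi> a'" and b': "b' \<in> U" "\<gamma> b = \<psi> b'"
      using x(2) H by (auto simp: elem_vertices_def)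
    text \<open>The edge through \<open>p\<close> is the same set when seen from \<open>H\<close>.\<close>
    have "p \<in> \<psi> ` (convex hull {a', b'})"
    proof (cases "H = E")
      case True
      then have "\<psi> = \<gamma>" "U = V" using H E' by auto
      moreover have "a' = a" "b' = b"
        using a' b' abV inj_onD[OF chart_inj[OF H1(1)]] hull_inc[of _ U convex] unfolding \<open>\<psi> = \<gamma>\<close> \<open>U = V\<close> by metis+
      ultimately show ?thesis using p' ab by auto
    next
      case False
      then have EH: "E \<noteq> H" by simp
      obtain W2 X2 where "W2 \<subset> fst E" "X2 \<subset> fst H" "snd E ` W2 = snd H ` X2"
          "elem_body E \<inter> elem_body H = snd E ` (convex hull W2)" "elem_body E \<inter> elem_body H = snd H ` (convex hull X2)"
        by (rule conforming[OF E H1(2) EH])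
      then have W2: "W2 \<subset> V" "X2 \<subset> U" "\<gamma> ` W2 = \<psi> ` X2"
          "elem_body E \<inter> elem_body H = \<gamma> ` (convex hull W2)" "elem_body E \<inter> elem_body H = \<psi> ` (convex hull X2)"
        using E' H by simp_all
      have vert: "v \<in> W2" if v: "v \<in> V" "\<gamma> v \<in> elem_vertices H" for v
      proof -
        have "\<gamma> v \<in> elem_vertices E" using v E' by (auto simp: elem_vertices_def)
        have "\<gamma> v \<in> snd E ` W2"
        proof (rule vertex_in_common_face[OF E])
          show "W2 \<subset> fst E" using W2(1) E' by simp
          show "\<gamma> v \<in> elem_vertices E" by fact
          have "\<gamma> v \<in> elem_body E \<inter> elem_body H"
            using v(2) \<open>\<gamma> v \<in> elem_vertices E\<close> vertex_subset_body by blast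
          then show "\<gamma> v \<in> snd E ` (convex hull W2)" unfolding W2(4) using E' by simp
        qed
        then obtain w where w: "w \<in> W2" "\<gamma> v = \<gamma> w" using E' by auto
        have "(V, \<gamma>) \<in> \<T>" using E E' by simp
        then have "v = w" using chart_inj w v W2(1) hull_inc[of _ V convex] by (metis inj_onD psubsetD)
        then show ?thesis using w by simp
      qed
      \<comment> \<open>A proper face of a simplex with at most three vertices has at most two of
        them, so the common face of \<open>E\<close> and \<open>H\<close> is the edge
        itself.\<close>
      have "{a, b} \<subseteq> W2" using vert abV x(2) by auto
      moreover have "card W2 < card V" using W2(1) simplex(1)[of V \<gamma>] E E' by (metis psubset_card_mono)
      then have "card W2 \<le> 2" using simplex(2)[of V \<gamma>] E E' dim by auto
      moreover have "finite W2" using W2(1) simplex(1)[of V \<gamma>] E E' by (metis finite_subset psubset_imp_subset)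
      ultimately have W2eq: "W2 = {a, b}" using ab(2)
        by (metis card_2_iff card_seteq)
      have "X2 = {a', b'}"
      proof -
        have "\<psi> ` X2 = \<psi> ` {a', b'}" using W2(3) unfolding W2eq a'(2)[symmetric] b'(2)[symmetric] image_insert image_empty by simp
        moreover have "inj_on \<psi> U" using chart_inj[OF H1(1)] hull_subset[of U convex] by (rule inj_on_subset)
        ultimately show ?thesis using W2(2) a' b' by (metis inj_on_image_eq_iff psubset_imp_subset insert_subset empty_subsetI)
      qed
      then have "\<psi> ` (convex hull {a', b'}) = \<gamma> ` (convex hull W)" using W2(4,5) W2eq ab by simp
      then show ?thesis using p' by auto
    qed
    then obtain p2 where p2: "p2 \<in> convex hull {a', b'}" "p = \<psi> p2" by auto
    obtain W3 X3 where "W3 \<subset> fst H" "X3 \<subset> fst H'" "snd H ` W3 = snd H' ` X3"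
        "elem_body H \<inter> elem_body H' = snd H ` (convex hull W3)"
      by (rule conforming[OF H1(2,3,4)])
    then have W3: "W3 \<subset> U" "X3 \<subset> fst H'" "\<psi> ` W3 = snd H' ` X3"
        "elem_body H \<inter> elem_body H' = \<psi> ` (convex hull W3)"
      using H by simp_all
    obtain x' where x': "x' \<in> convex hull W3" "x = \<psi> x'" using W3(4) x(4,5) by auto
    \<comment> \<open>As \<open>H'\<close> is outside the star of the edge, the face through
      \<open>x\<close> misses one endpoint; \<open>edge_estimate\<close> then places
      \<open>p\<close> near the other one.\<close>
    have "a' \<notin> W3 \<or> b' \<notin> W3"
    proof (rule ccontr)
      assume "\<not> ?thesis"
      then have "\<gamma> a \<in> snd H' ` X3" "\<gamma> b \<in> snd H' ` X3" using a' b' W3(3) by auto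
      then show False using W3(2) x(3) by (auto simp: elem_vertices_def)
    qed
    moreover have px: "M * \<kappa> * \<sigma> ^ 3 * dist p x \<le> M * \<kappa> * \<sigma> ^ 3 * D"
      using C(5)[OF x(1)] Mpos by (rule mult_left_mono)
    ultimately have "dist p (\<gamma> b) \<le> M * \<kappa> * \<sigma> ^ 3 * D \<or> dist p (\<gamma> a) \<le> M * \<kappa> * \<sigma> ^ 3 * D"
      using edge_estimate[OF H1(1) a'(1) b'(1) p2(1) _ _ x'(1)] W3(1)
        edge_estimate[OF H1(1) b'(1) a'(1) _ _ _ x'(1), of p2] p2 x' a' b' by (auto simp: insert_commute)
    then show ?thesis using abV E' by (auto simp: elem_vertices_def)
  qed
qed

text \<open>A short connection leaves \<open>E\<close> at a point \<open>p\<close> close to a vertex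
  \<open>b\<close> of \<open>E\<close>. Since \<open>b\<close> cannot belong to \<open>F\<close>,
  the gap between a node and an element without it bounds the length of the route from
  \<open>b\<close> over \<open>p\<close> to \<open>s\<close>.\<close>

proposition disjoint_elements_separation:
  assumes E: "E \<in> \<T>" and F: "F \<in> \<T>" "elem_body E \<inter> elem_body F = {}"
    and t: "t \<in> elem_body E" and s: "s \<in> elem_body F"
  shows "separation_const K \<sigma> \<kappa> * h \<le> dist t s"
proof -
  let ?m = "M * \<kappa> * \<sigma> ^ 3"
  have m0: "?m > 0" using M_pos pos by simp
  have ts: "t \<in> \<Gamma>" "s \<in> \<Gamma>" using t s E F body_subset by blast+
  have "h / (M * \<sigma> * K) / (2 * ?m + 2) \<le> D" if D: "K * dist t s < D" for D
  proof -
    obtain C where C: "connected C" "C \<subseteq> \<Gamma>" "t \<in> C" "s \<in> C" "\<And>z. z \<in> C \<Longrightarrow> dist t z \<le> D"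
      using connection[OF ts D] by blast
    obtain p G where p: "p \<in> C" "G \<in> \<T> - {E}" "p \<in> elem_body E" "p \<in> elem_body G"
    proof (rule crossing_point[OF C(1,2), of "{E}"])
      show "C \<inter> (\<Union>E\<in>{E}. elem_body E) \<noteq> {}" using t C(3) by blast
      show "C \<inter> (\<Union>E\<in>\<T> - {E}. elem_body E) \<noteq> {}" using F t s C(4) by blast
    qed (use E in auto)
    have near: "dist p x \<le> 2 * D" if "x \<in> C" for x
      using C(5)[OF that] C(5)[OF p(1)] dist_triangle3[of p x t] by simp
    obtain b where b: "b \<in> elem_vertices E" "dist p b \<le> ?m * (2 * D)"
      using close_to_vertex[OF E _ _ F C(1,2) p(1) C(4) near p(3,4) s] p(2) by auto
    have "b \<notin> elem_vertices F" using b F(2) vertex_subset_body by blast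
    then have "h / (M * \<sigma> * K) \<le> dist b s"
      using node_star_separation[OF vertex_is_node[OF E b(1)] F(1) _ s] by simp
    also have "\<dots> \<le> dist p b + dist p s" by (rule dist_triangle3)
    also have "\<dots> \<le> ?m * (2 * D) + 2 * D" using b(2) near[OF C(4)] by simp
    also have "\<dots> = D * (2 * ?m + 2)" by (simp add: algebra_simps)
    finally show ?thesis using m0 by (subst pos_divide_le_eq) auto
  qed
  then have "h / (M * \<sigma> * K) / (2 * ?m + 2) \<le> K * dist t s" by (rule dense_ge)
  then have "h / (M * \<sigma> * K) / (2 * ?m + 2) / K \<le> dist t s" unfolding pos_divide_le_eq[OF K_pos] mult.commute[of "dist t s" K] .
  also have "h / (M * \<sigma> * K) / (2 * ?m + 2) / K = separation_const K \<sigma> \<kappa> * h"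
    by (simp add: separation_const_def power2_eq_square)
  finally show ?thesis .
qed

end

section \<open>Norms on the surface\<close>

lemma space_surface_measure [simp]: "space (surface_measure \<tau>) = \<tau>"
  by (simp add: surface_measure_def space_restrict_space)

lemma measurable_surface_id [measurable]:
  "(\<lambda>x. x) \<in> borel_measurable (surface_measure \<tau>)"
  unfolding surface_measure_def by (intro measurable_restrict_space1 measurable_ident_sets) simp

lemma sets_surface_measureI: "X \<in> sets borel \<Longrightarrow> X \<inter> \<tau> \<in> sets (surface_measure \<tau>)"
  unfolding surface_measure_def by (auto simp: sets_restrict_space Int_commute)

lemma emeasure_surface_measure:
  fixes X :: "'a::euclidean_space set"
  assumes "\<tau> \<in> sets borel" "X \<subseteq> \<tau>"
  shows "emeasure (surface_measure \<tau>) X = emeasure (hausdorff_measure (DIM('a) - 1)) X"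
  unfolding surface_measure_def using assms by (simp add: emeasure_restrict_space)

text \<open>Writing all patch integrals with the one measure on \<Gamma> and indicators allows them
  to be summed and compared under a common integral.\<close>

lemma nn_integral_surface_subset:
  assumes "\<tau> \<in> sets borel" "\<Gamma> \<in> sets borel" "\<tau> \<subseteq> \<Gamma>"
  shows "(\<integral>\<^sup>+x. f x \<partial>surface_measure \<tau>) = (\<integral>\<^sup>+x. f x * indicator \<tau> x \<partial>surface_measure \<Gamma>)"
proof -
  have "indicator \<tau> x * indicator \<Gamma> x = (indicator \<tau> x :: ennreal)" for x
    using assms(3) by (auto simp: indicator_def)
  then show ?thesis unfolding surface_measure_def using assms
    by (simp add: nn_integral_restrict_space mult.assoc)
qed

lemma L2_norm_sq_subset:
  assumes "\<tau> \<in> sets borel" "\<Gamma> \<in> sets borel" "\<tau> \<subseteq> \<Gamma>"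
  shows "L2_norm_sq \<tau> v = (\<integral>\<^sup>+x. ennreal ((v x)\<^sup>2) * indicator \<tau> x \<partial>surface_measure \<Gamma>)"
  unfolding L2_norm_sq_def by (rule nn_integral_surface_subset[OF assms])

definition slobodeckij :: "('a::euclidean_space \<Rightarrow> real) \<Rightarrow> 'a \<Rightarrow> 'a \<Rightarrow> ennreal" where
  "slobodeckij v t s = ennreal (\<bar>v t - v s\<bar>\<^sup>2 / norm (t - s) ^ DIM('a))"

lemma Hhalf_seminorm_sq_subset:
  assumes "\<tau> \<in> sets borel" "\<Gamma> \<in> sets borel" "\<tau> \<subseteq> \<Gamma>"
  shows "Hhalf_seminorm_sq \<tau> v =
    (\<integral>\<^sup>+t. (\<integral>\<^sup>+s. slobodeckij v t s * indicator \<tau> s \<partial>surface_measure \<Gamma>) * indicator \<tau> t \<partial>surface_measure \<Gamma>)"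
  unfolding Hhalf_seminorm_sq_def slobodeckij_def nn_integral_surface_subset[OF assms] ..

lemma Hhalf_seminorm_sq_eq:
  "Hhalf_seminorm_sq \<Gamma> v = (\<integral>\<^sup>+t. (\<integral>\<^sup>+s. slobodeckij v t s \<partial>surface_measure \<Gamma>) \<partial>surface_measure \<Gamma>)"
  unfolding Hhalf_seminorm_sq_def slobodeckij_def ..

lemma slobodeckij_measurable [measurable]:
  assumes [measurable]: "v \<in> borel_measurable M" and [measurable]: "(\<lambda>x. x) \<in> borel_measurable M"
  shows "(\<lambda>(t, s). slobodeckij v t s) \<in> borel_measurable (M \<Otimes>\<^sub>M M)"
  unfolding slobodeckij_def by measurable

lemma ennreal_double_sum:
  "0 \<le> a \<Longrightarrow> 0 \<le> b \<Longrightarrow> ennreal (2 * a + 2 * b) = 2 * ennreal a + 2 * ennreal b"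
  by (simp add: ennreal_plus ennreal_mult)

lemma ennreal_square_add_le: "ennreal ((x + y)\<^sup>2) \<le> 2 * ennreal (x\<^sup>2) + 2 * ennreal (y\<^sup>2)"
proof -
  have "(x + y)\<^sup>2 \<le> 2 * x\<^sup>2 + 2 * y\<^sup>2" using sum_squares_bound[of x y] by (simp add: power2_sum)
  then have "ennreal ((x + y)\<^sup>2) \<le> ennreal (2 * x\<^sup>2 + 2 * y\<^sup>2)" by (rule ennreal_leI)
  then show ?thesis by (simp only: ennreal_double_sum zero_le_power2)
qed

lemma L2_norm_sq_add_le:
  assumes [measurable]: "u \<in> borel_measurable (surface_measure \<Gamma>)" "v \<in> borel_measurable (surface_measure \<Gamma>)"
  shows "L2_norm_sq \<Gamma> (\<lambda>x. u x + v x) \<le> 2 * L2_norm_sq \<Gamma> u + 2 * L2_norm_sq \<Gamma> v"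
proof -
  have "L2_norm_sq \<Gamma> (\<lambda>x. u x + v x)
      \<le> (\<integral>\<^sup>+x. 2 * ennreal ((u x)\<^sup>2) + 2 * ennreal ((v x)\<^sup>2) \<partial>surface_measure \<Gamma>)"
    unfolding L2_norm_sq_def by (intro nn_integral_mono ennreal_square_add_le)
  also have "\<dots> = 2 * L2_norm_sq \<Gamma> u + 2 * L2_norm_sq \<Gamma> v"
    unfolding L2_norm_sq_def by (simp add: nn_integral_add nn_integral_cmult)
  finally show ?thesis .
qed

lemma slobodeckij_add_le:
  "slobodeckij (\<lambda>x. u x + v x) t s \<le> 2 * slobodeckij u t s + 2 * slobodeckij v t s"
proof -
  let ?d = "norm (t - s) ^ DIM('a)"
  have "\<bar>(u t + v t) - (u s + v s)\<bar>\<^sup>2 \<le> 2 * \<bar>u t - u s\<bar>\<^sup>2 + 2 * \<bar>v t - v s\<bar>\<^sup>2"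
    using sum_squares_bound[of "u t - u s" "v t - v s"] by (simp add: power2_eq_square algebra_simps)
  then have "\<bar>(u t + v t) - (u s + v s)\<bar>\<^sup>2 / ?d \<le> 2 * (\<bar>u t - u s\<bar>\<^sup>2 / ?d) + 2 * (\<bar>v t - v s\<bar>\<^sup>2 / ?d)"
    by (simp add: divide_right_mono add_divide_distrib[symmetric])
  then have "ennreal (\<bar>(u t + v t) - (u s + v s)\<bar>\<^sup>2 / ?d)
      \<le> ennreal (2 * (\<bar>u t - u s\<bar>\<^sup>2 / ?d) + 2 * (\<bar>v t - v s\<bar>\<^sup>2 / ?d))" by (rule ennreal_leI)
  also have "\<dots> = 2 * slobodeckij u t s + 2 * slobodeckij v t s"
    unfolding slobodeckij_def by (rule ennreal_double_sum) auto
  finally show ?thesis unfolding slobodeckij_def .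
qed

lemma Hhalf_seminorm_sq_add_le:
  assumes "sigma_finite_measure (surface_measure \<Gamma>)"
    and [measurable]: "u \<in> borel_measurable (surface_measure \<Gamma>)" "v \<in> borel_measurable (surface_measure \<Gamma>)"
  shows "Hhalf_seminorm_sq \<Gamma> (\<lambda>x. u x + v x) \<le> 2 * Hhalf_seminorm_sq \<Gamma> u + 2 * Hhalf_seminorm_sq \<Gamma> v"
proof -
  interpret sigma_finite_measure "surface_measure \<Gamma>" by fact
  have "Hhalf_seminorm_sq \<Gamma> (\<lambda>x. u x + v x)
    \<le> (\<integral>\<^sup>+t. (\<integral>\<^sup>+s. 2 * slobodeckij u t s + 2 * slobodeckij v t s \<partial>surface_measure \<Gamma>) \<partial>surface_measure \<Gamma>)"
    unfolding Hhalf_seminorm_sq_eq by (intro nn_integral_mono slobodeckij_add_le)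
  also have "\<dots> = (\<integral>\<^sup>+t. 2 * (\<integral>\<^sup>+s. slobodeckij u t s \<partial>surface_measure \<Gamma>)
        + 2 * (\<integral>\<^sup>+s. slobodeckij v t s \<partial>surface_measure \<Gamma>) \<partial>surface_measure \<Gamma>)"
    by (intro nn_integral_cong) (simp add: nn_integral_add nn_integral_cmult)
  also have "\<dots> = 2 * Hhalf_seminorm_sq \<Gamma> u + 2 * Hhalf_seminorm_sq \<Gamma> v"
    unfolding Hhalf_seminorm_sq_eq by (simp add: nn_integral_add nn_integral_cmult)
  finally show ?thesis .
qed

lemma Hhalf_norm_sq_add_le:
  assumes "sigma_finite_measure (surface_measure \<Gamma>)"
    and "u \<in> borel_measurable (surface_measure \<Gamma>)" "v \<in> borel_measurable (surface_measure \<Gamma>)"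
  shows "Hhalf_norm_sq \<Gamma> (\<lambda>x. u x + v x) \<le> 2 * Hhalf_norm_sq \<Gamma> u + 2 * Hhalf_norm_sq \<Gamma> v"
  unfolding Hhalf_norm_sq_def
  using add_mono[OF L2_norm_sq_add_le[OF assms(2,3)] Hhalf_seminorm_sq_add_le[OF assms]]
  by (simp add: algebra_simps)

lemma Hhalf_norm_sq_minus: "Hhalf_norm_sq \<Gamma> (\<lambda>x. - v x) = Hhalf_norm_sq \<Gamma> v"
  by (simp add: Hhalf_norm_sq_def L2_norm_sq_def Hhalf_seminorm_sq_def abs_minus_commute)

section \<open>Estimates on patches\<close>

text \<open>Each point of \<Gamma> outside the support has an open neighbourhood on which
  \<open>f\<close> vanishes almost everywhere. The Lindelof property leaves countably many of these,
  so the exceptional null sets can be united.\<close>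

lemma AE_zero_off_ess_support:
  fixes \<tau> :: "'a::euclidean_space set"
  assumes "ess_support \<Gamma> f \<subseteq> \<tau>"
  shows "AE s in surface_measure \<Gamma>. s \<notin> \<tau> \<longrightarrow> f s = 0"
proof -
  define \<F> where "\<F> = {U. open U \<and> (AE s in surface_measure \<Gamma>. s \<in> U \<longrightarrow> f s = 0)}"
  obtain \<F>' where F': "\<F>' \<subseteq> \<F>" "countable \<F>'" "\<Union>\<F>' = \<Union>\<F>"
    using Lindelof[of \<F>] unfolding \<F>_def by blast
  have "AE s in surface_measure \<Gamma>. \<forall>U\<in>\<F>'. s \<in> U \<longrightarrow> f s = 0"
    using F'(1,2) by (subst AE_ball_countable) (auto simp: \<F>_def)
  moreover have "AE s in surface_measure \<Gamma>. s \<in> \<Gamma>" by (rule AE_I2) simp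
  ultimately show ?thesis
  proof eventually_elim
    case (elim s)
    show ?case
    proof
      assume "s \<notin> \<tau>"
      then have "s \<notin> ess_support \<Gamma> f" using assms by auto
      then have "s \<in> \<Union>\<F>" using elim(2) unfolding ess_support_def \<F>_def by blast
      then show "f s = 0" using elim(1) F'(3) by blast
    qed
  qed
qed

lemma integrable_mult_L2:
  assumes "u \<in> L2_space \<Gamma>" "v \<in> L2_space \<Gamma>"
  shows "integrable (surface_measure \<Gamma>) (\<lambda>s. u s * v s)"
proof -
  have [measurable]: "u \<in> borel_measurable (surface_measure \<Gamma>)" "v \<in> borel_measurable (surface_measure \<Gamma>)"
    and fin: "L2_norm_sq \<Gamma> u < \<infinity>" "L2_norm_sq \<Gamma> v < \<infinity>" using assms by (auto simp: L2_space_def)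
  have i: "integrable (surface_measure \<Gamma>) (\<lambda>s. (u s)\<^sup>2)" "integrable (surface_measure \<Gamma>) (\<lambda>s. (v s)\<^sup>2)"
    using fin by (auto intro!: integrableI_bounded simp: L2_norm_sq_def)
  show ?thesis
  proof (rule Bochner_Integration.integrable_bound[OF Bochner_Integration.integrable_add[OF i]])
    have "\<bar>u s * v s\<bar> \<le> (u s)\<^sup>2 + (v s)\<^sup>2" for s
    proof -
      have "2 * \<bar>u s\<bar> * \<bar>v s\<bar> \<le> (u s)\<^sup>2 + (v s)\<^sup>2"
        using sum_squares_bound[of "\<bar>u s\<bar>" "\<bar>v s\<bar>"] by simp
      then show ?thesis unfolding abs_mult using mult_nonneg_nonneg[of "\<bar>u s\<bar>" "\<bar>v s\<bar>"] by linarith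
    qed
    then show "AE s in surface_measure \<Gamma>. norm (u s * v s) \<le> norm ((u s)\<^sup>2 + (v s)\<^sup>2)" by auto
  qed measurable
qed

text \<open>Testing with \<open>\<phi>\<close> gives \<open>w t = \<integral> (w t - w s) \<phi> s ds\<close>, so that the Cauchy-Schwarz inequality
  bounds \<open>w\<close> by its seminorm without any Poincare inequality for the patch.\<close>

proposition L2_le_seminorm:
  fixes \<tau> \<Gamma> :: "'a::euclidean_space set"
  assumes \<tau>: "\<tau> \<in> sets borel" "\<Gamma> \<in> sets borel" "\<tau> \<subseteq> \<Gamma>"
    and sf: "sigma_finite_measure (surface_measure \<Gamma>)"
    and d: "\<And>t s. t \<in> \<tau> \<Longrightarrow> s \<in> \<tau> \<Longrightarrow> dist t s \<le> d"
    and \<phi>: "\<phi> \<in> L2_space \<Gamma>" "(LINT s|surface_measure \<Gamma>. \<phi> s) = 1" "ess_support \<Gamma> \<phi> \<subseteq> \<tau>"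
    and q: "L2_norm_sq \<tau> \<phi> \<le> ennreal q" "q \<ge> 0" and "d \<ge> 0"
    and w: "w \<in> L2_space \<Gamma>" "(LINT s|surface_measure \<Gamma>. w s * \<phi> s) = 0"
  shows "L2_norm_sq \<tau> w \<le> ennreal (q * d ^ DIM('a)) * Hhalf_seminorm_sq \<tau> w"
proof -
  let ?M = "surface_measure \<Gamma>"
  interpret sigma_finite_measure ?M by fact
  have [measurable]: "w \<in> borel_measurable ?M" "\<phi> \<in> borel_measurable ?M"
    using w \<phi> by (auto simp: L2_space_def)
  have [measurable]: "\<tau> \<in> sets ?M" using sets_surface_measureI[OF \<tau>(1), of \<Gamma>] \<tau>(3) by (simp add: Int_absorb2)
  \<comment> \<open>A function that is not integrable has Bochner integral 0, not 1.\<close>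
  have int\<phi>: "integrable ?M \<phi>" using \<phi>(2) not_integrable_integral_eq[of ?M \<phi>] by fastforce
  have intw: "integrable ?M (\<lambda>s. w s * \<phi> s)" by (rule integrable_mult_L2[OF w(1) \<phi>(1)])
  have pt: "ennreal ((w t)\<^sup>2) \<le> ennreal (q * d ^ DIM('a)) * (\<integral>\<^sup>+s. slobodeckij w t s * indicator \<tau> s \<partial>?M)"
    if t: "t \<in> \<tau>" for t
  proof -
    let ?D = "\<lambda>s. ennreal \<bar>w t - w s\<bar> * indicator \<tau> s"
    let ?p = "\<lambda>s. ennreal \<bar>\<phi> s\<bar> * indicator \<tau> s"
    have "w t = (LINT s|?M. w t * \<phi> s - w s * \<phi> s)"
      using int\<phi> intw \<phi>(2) w(2) by simp
    also have "\<dots> = (LINT s|?M. (w t - w s) * \<phi> s)" by (simp add: left_diff_distrib)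
    finally have "ennreal \<bar>w t\<bar> = ennreal (norm (LINT s|?M. (w t - w s) * \<phi> s))" by simp
    also have "\<dots> \<le> (\<integral>\<^sup>+s. ennreal (norm ((w t - w s) * \<phi> s)) \<partial>?M)"
      by (rule integral_norm_bound_ennreal) (use int\<phi> intw in \<open>simp add: left_diff_distrib\<close>)
    also have "\<dots> = (\<integral>\<^sup>+s. ?D s * ?p s \<partial>?M)"
    proof (rule nn_integral_cong_AE)
      show "AE s in ?M. ennreal (norm ((w t - w s) * \<phi> s)) = ?D s * ?p s"
        using AE_zero_off_ess_support[OF \<phi>(3)]
        by eventually_elim (auto simp: indicator_def abs_mult ennreal_mult)
    qed
    finally have "(ennreal \<bar>w t\<bar>)\<^sup>2 \<le> (\<integral>\<^sup>+s. ?D s * ?p s \<partial>?M)\<^sup>2" by (intro power_mono) auto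
    also have "\<dots> \<le> (\<integral>\<^sup>+s. (?D s)\<^sup>2 \<partial>?M) * (\<integral>\<^sup>+s. (?p s)\<^sup>2 \<partial>?M)"
      by (rule Cauchy_Schwarz_nn_integral) measurable
    also have "(\<integral>\<^sup>+s. (?p s)\<^sup>2 \<partial>?M) = L2_norm_sq \<tau> \<phi>"
      unfolding L2_norm_sq_subset[OF \<tau>]
      by (intro nn_integral_cong) (auto simp: indicator_def ennreal_power)
    also have "(\<integral>\<^sup>+s. (?D s)\<^sup>2 \<partial>?M) * L2_norm_sq \<tau> \<phi>
        \<le> (\<integral>\<^sup>+s. ennreal (d ^ DIM('a)) * (slobodeckij w t s * indicator \<tau> s) \<partial>?M) * ennreal q"
    \<comment> \<open>On the patch the ratio d / norm (t - s) is at least 1, which inserts the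
      kernel at the price of d^n. On the diagonal the left side vanishes.\<close>
    proof (rule mult_mono[OF nn_integral_mono q(1)])
      fix s
      show "(?D s)\<^sup>2 \<le> ennreal (d ^ DIM('a)) * (slobodeckij w t s * indicator \<tau> s)"
      proof (cases "s \<in> \<tau> \<and> s \<noteq> t")
        case True
        then have "norm (t - s) ^ DIM('a) \<le> d ^ DIM('a)"
          using d[OF t, of s] by (intro power_mono) (auto simp: dist_norm)
        moreover have "norm (t - s) ^ DIM('a) > 0" using True by auto
        ultimately have "\<bar>w t - w s\<bar>\<^sup>2 \<le> d ^ DIM('a) * (\<bar>w t - w s\<bar>\<^sup>2 / norm (t - s) ^ DIM('a))"
          by (simp add: pos_le_divide_eq mult_right_mono mult.commute)
        then have "ennreal (\<bar>w t - w s\<bar>\<^sup>2) \<le> ennreal (d ^ DIM('a)) * slobodeckij w t s"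
          unfolding slobodeckij_def using \<open>d \<ge> 0\<close> by (subst ennreal_mult[symmetric]) (auto intro: ennreal_leI)
        then show ?thesis using True by (simp add: ennreal_power)
      qed (auto simp: indicator_def)
    qed auto
    also have "\<dots> = ennreal (q * d ^ DIM('a)) * (\<integral>\<^sup>+s. slobodeckij w t s * indicator \<tau> s \<partial>?M)"
      using q(2) \<open>d \<ge> 0\<close> t \<tau>(3) by (subst nn_integral_cmult) (auto simp: ennreal_mult mult_ac)
    finally show ?thesis by (simp add: ennreal_power)
  qed
  have "L2_norm_sq \<tau> w \<le> (\<integral>\<^sup>+t. ennreal (q * d ^ DIM('a)) *
      ((\<integral>\<^sup>+s. slobodeckij w t s * indicator \<tau> s \<partial>?M) * indicator \<tau> t) \<partial>?M)"
    unfolding L2_norm_sq_subset[OF \<tau>] using pt by (intro nn_integral_mono) (auto simp: indicator_def)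
  also have "\<dots> = ennreal (q * d ^ DIM('a)) * Hhalf_seminorm_sq \<tau> w"
    unfolding Hhalf_seminorm_sq_subset[OF \<tau>] by (rule nn_integral_cmult) measurable
  finally show ?thesis .
qed

section \<open>The far field\<close>

definition far_kernel :: "real \<Rightarrow> 'a::euclidean_space \<Rightarrow> 'a \<Rightarrow> ennreal" where
  "far_kernel \<rho> t s = (if \<rho> \<le> dist t s then ennreal (1 / dist t s ^ DIM('a)) else 0)"

lemma far_kernel_commute: "far_kernel \<rho> t s = far_kernel \<rho> s t"
  by (simp add: far_kernel_def dist_commute)

lemma far_kernel_measurable [measurable]:
  assumes [measurable]: "(\<lambda>x. x) \<in> borel_measurable M"
  shows "(\<lambda>(t, s). far_kernel \<rho> t s) \<in> borel_measurable (M \<Otimes>\<^sub>M M)"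
  unfolding far_kernel_def by measurable

text \<open>Dyadic decomposition of the complement of \<open>ball t \<rho>\<close>.\<close>

lemma far_kernel_integral_le:
  fixes t :: "'a::euclidean_space"
  assumes [measurable]: "(\<lambda>x. x) \<in> borel_measurable M" and "\<rho> > 0" "A \<ge> 0" and n: "DIM('a) = Suc m"
    and A: "\<And>r. r > 0 \<Longrightarrow> emeasure M (space M \<inter> ball t r) \<le> ennreal (A * r ^ m)"
  shows "(\<integral>\<^sup>+s. far_kernel \<rho> t s \<partial>M) \<le> ennreal (2 ^ DIM('a) * A / \<rho>)"
proof -
  define B where "B k = space M \<inter> ball t (2 ^ Suc k * \<rho>)" for k :: nat
  define f where "f s k = ennreal (1 / (2 ^ k * \<rho>) ^ DIM('a)) * indicator (B k) s" for s k
  have [measurable]: "B k \<in> sets M" for k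
  proof -
    have "B k = {x \<in> space M. dist t x < 2 ^ Suc k * \<rho>}" by (auto simp: B_def)
    also have "\<dots> \<in> sets M" by measurable
    finally show ?thesis .
  qed
  have "(\<integral>\<^sup>+s. far_kernel \<rho> t s \<partial>M)
      \<le> (\<integral>\<^sup>+s. (\<Sum>k. f s k) \<partial>M)"
  proof (rule nn_integral_mono)
    fix s assume s: "s \<in> space M"
    show "far_kernel \<rho> t s \<le> (\<Sum>k. f s k)"
    proof (cases "\<rho> \<le> dist t s")
      case True
      have ex: "\<exists>k. dist t s < 2 ^ Suc k * \<rho>"
      proof -
        obtain k :: nat where "dist t s / \<rho> < 2 ^ k" using real_arch_pow[of 2 "dist t s / \<rho>"] by auto
        then have "dist t s < 2 ^ k * \<rho>" using \<open>\<rho> > 0\<close> by (simp add: pos_divide_less_eq)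
        also have "\<dots> \<le> 2 ^ Suc k * \<rho>" using \<open>\<rho> > 0\<close> by simp
        finally show ?thesis ..
      qed
      define k where "k = (LEAST k. dist t s < 2 ^ Suc k * \<rho>)"
      have k: "dist t s < 2 ^ Suc k * \<rho>" unfolding k_def by (rule LeastI_ex[OF ex])
      have k': "2 ^ k * \<rho> \<le> dist t s"
      proof (cases k)
        case (Suc j)
        then have "\<not> dist t s < 2 ^ Suc j * \<rho>" unfolding k_def using not_less_Least[of j "\<lambda>k. dist t s < 2 ^ Suc k * \<rho>"] by simp
        then show ?thesis using Suc by simp
      qed (use True in simp)
      have "far_kernel \<rho> t s = ennreal (1 / dist t s ^ DIM('a))" using True by (simp add: far_kernel_def)
      also have "\<dots> \<le> ennreal (1 / (2 ^ k * \<rho>) ^ DIM('a)) * indicator (B k) s"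
      proof -
        have x: "2 ^ k * \<rho> > 0" using \<open>\<rho> > 0\<close> by simp
        then have "dist t s > 0" using k' by linarith
        then have "1 / dist t s ^ DIM('a) \<le> 1 / (2 ^ k * \<rho>) ^ DIM('a)"
          using x k' \<open>\<rho> > 0\<close> by (intro divide_left_mono power_mono mult_pos_pos zero_less_power) auto
        then have "ennreal (1 / dist t s ^ DIM('a)) \<le> ennreal (1 / (2 ^ k * \<rho>) ^ DIM('a))"
          by (rule ennreal_leI)
        moreover have "s \<in> B k" using k s by (auto simp: B_def)
        ultimately show ?thesis by (simp only: indicator_simps mult_1_right)
      qed
      also have "\<dots> = f s k" by (simp only: f_def)
      also have "\<dots> \<le> (\<Sum>k. f s k)" using sum_le_suminf[of "f s" "{k}"] by simp
      finally show ?thesis .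
    qed (simp add: far_kernel_def)
  qed
  also have "\<dots> = (\<Sum>k. ennreal (1 / (2 ^ k * \<rho>) ^ DIM('a)) * emeasure M (B k))"
    unfolding f_def by (subst nn_integral_suminf) (auto simp: nn_integral_cmult_indicator)
  \<comment> \<open>The kernel contributes the power -(m + 1) of 2^k \<rho> and the measure of the
    ball the power m. One negative power remains, hence a geometric series of ratio 1/2.\<close>
  also have "\<dots> \<le> (\<Sum>k. ennreal (2 ^ m * A / \<rho> * (1 / 2) ^ k))"
  proof (intro suminf_le allI)
    fix k
    let ?x = "2 ^ k * \<rho>"
    have x: "?x > 0" using \<open>\<rho> > 0\<close> by simp
    have "ennreal (1 / ?x ^ DIM('a)) * emeasure M (B k) \<le> ennreal (1 / ?x ^ DIM('a)) * ennreal (A * (2 * ?x) ^ m)"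
      using A[of "2 ^ Suc k * \<rho>"] \<open>\<rho> > 0\<close> by (intro mult_left_mono) (auto simp: mult.assoc B_def)
    also have "\<dots> = ennreal (1 / ?x ^ DIM('a) * (A * (2 * ?x) ^ m))"
      using x \<open>A \<ge> 0\<close> by (intro ennreal_mult[symmetric]) auto
    also have "1 / ?x ^ DIM('a) * (A * (2 * ?x) ^ m) = 2 ^ m * A / ?x"
      unfolding n power_mult_distrib[of 2 ?x] using x by simp
    also have "\<dots> = 2 ^ m * A / \<rho> * (1 / 2) ^ k" by (simp add: power_one_over field_simps)
    finally show "ennreal (1 / ?x ^ DIM('a)) * emeasure M (B k) \<le> ennreal (2 ^ m * A / \<rho> * (1 / 2) ^ k)" .
  qed auto
  also have "\<dots> = ennreal (\<Sum>k. 2 ^ m * A / \<rho> * (1 / 2) ^ k)"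
    using \<open>A \<ge> 0\<close> \<open>\<rho> > 0\<close> by (intro suminf_ennreal2 summable_mult summable_geometric) auto
  also have "(\<Sum>k. 2 ^ m * A / \<rho> * (1 / 2) ^ k) = 2 ^ m * A / \<rho> * 2"
    using \<open>\<rho> > 0\<close> by (subst suminf_mult) (auto simp: suminf_geometric summable_geometric)
  finally show ?thesis using n by (simp add: mult_ac)
qed

text \<open>The factor 4 is 2 + 2: exchanging the order of integration and the symmetry of
  \<open>far_kernel\<close> give the terms in \<open>w t\<close> and \<open>w s\<close> the same
  bound.\<close>

proposition seminorm_le_near_plus_far:
  fixes \<Gamma> :: "'a::euclidean_space set"
  assumes "\<Gamma> \<in> sets borel" and sf: "sigma_finite_measure (surface_measure \<Gamma>)"
    and [measurable]: "w \<in> borel_measurable (surface_measure \<Gamma>)"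
    and N: "finite N" "\<And>y. y \<in> N \<Longrightarrow> \<tau> y \<in> sets borel" "\<And>y. y \<in> N \<Longrightarrow> \<tau> y \<subseteq> \<Gamma>"
    and near: "\<And>t s. t \<in> \<Gamma> \<Longrightarrow> s \<in> \<Gamma> \<Longrightarrow> dist t s < \<rho> \<Longrightarrow> \<exists>y\<in>N. t \<in> \<tau> y \<and> s \<in> \<tau> y"
    and ker: "\<And>t. t \<in> \<Gamma> \<Longrightarrow> (\<integral>\<^sup>+s. far_kernel \<rho> t s \<partial>surface_measure \<Gamma>) \<le> Q"
  shows "Hhalf_seminorm_sq \<Gamma> w \<le> (\<Sum>y\<in>N. Hhalf_seminorm_sq (\<tau> y) w) + 4 * Q * L2_norm_sq \<Gamma> w"
proof -
  let ?M = "surface_measure \<Gamma>"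
  interpret sigma_finite_measure ?M by fact
  interpret pair_sigma_finite ?M ?M ..
  have \<tau>M [measurable]: "\<tau> y \<in> sets ?M" if "y \<in> N" for y
    using sets_surface_measureI[OF N(2)[OF that], of \<Gamma>] N(3)[OF that] by (simp add: Int_absorb2)
  let ?q = "\<lambda>t. ennreal ((w t)\<^sup>2)"
  let ?n = "\<lambda>y t s. slobodeckij w t s * indicator (\<tau> y) s * indicator (\<tau> y) t"
  have pt: "slobodeckij w t s \<le> (\<Sum>y\<in>N. ?n y t s) + (2 * (?q t * far_kernel \<rho> t s) + 2 * (?q s * far_kernel \<rho> t s))"
    if ts: "t \<in> \<Gamma>" "s \<in> \<Gamma>" for t s
  proof (cases "dist t s < \<rho>")
    case True
    then obtain y where y: "y \<in> N" "t \<in> \<tau> y" "s \<in> \<tau> y" using near ts by blast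
    have "slobodeckij w t s = ?n y t s" using y by simp
    also have "\<dots> \<le> (\<Sum>y\<in>N. ?n y t s)" using y N(1) by (intro member_le_sum) auto
    finally show ?thesis by (rule order_trans) simp
  next
    case False
    let ?d = "norm (t - s) ^ DIM('a)"
    have "\<bar>w t - w s\<bar>\<^sup>2 \<le> 2 * (w t)\<^sup>2 + 2 * (w s)\<^sup>2"
      using sum_squares_bound[of "w t" "- w s"] by (simp add: power2_eq_square algebra_simps)
    then have "slobodeckij w t s \<le> ennreal ((2 * (w t)\<^sup>2 + 2 * (w s)\<^sup>2) * (1 / ?d))"
      unfolding slobodeckij_def by (intro ennreal_leI) (simp add: divide_right_mono)
    also have "\<dots> = (2 * ?q t + 2 * ?q s) * ennreal (1 / ?d)"
      by (subst ennreal_mult) (auto simp: ennreal_plus ennreal_mult)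
    also have "ennreal (1 / ?d) = far_kernel \<rho> t s" using False by (simp add: far_kernel_def dist_norm)
    finally have "slobodeckij w t s \<le> 2 * (?q t * far_kernel \<rho> t s) + 2 * (?q s * far_kernel \<rho> t s)"
      by (simp add: distrib_right mult.assoc)
    then show ?thesis by (rule order_trans) simp
  qed
  have one: "(\<integral>\<^sup>+t. (\<integral>\<^sup>+s. ?q t * far_kernel \<rho> t s \<partial>?M) \<partial>?M) \<le> Q * L2_norm_sq \<Gamma> w"
  proof -
    have "(\<integral>\<^sup>+t. (\<integral>\<^sup>+s. ?q t * far_kernel \<rho> t s \<partial>?M) \<partial>?M) = (\<integral>\<^sup>+t. ?q t * (\<integral>\<^sup>+s. far_kernel \<rho> t s \<partial>?M) \<partial>?M)"
      by (intro nn_integral_cong nn_integral_cmult) measurable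
    also have "\<dots> \<le> (\<integral>\<^sup>+t. Q * ?q t \<partial>?M)"
    proof (rule nn_integral_mono)
      fix t assume "t \<in> space ?M"
      then show "?q t * (\<integral>\<^sup>+s. far_kernel \<rho> t s \<partial>?M) \<le> Q * ?q t"
        using ker[of t] by (subst mult.commute) (auto intro: mult_right_mono)
    qed
    also have "\<dots> = Q * L2_norm_sq \<Gamma> w" unfolding L2_norm_sq_def by (rule nn_integral_cmult) measurable
    finally show ?thesis .
  qed
  have two: "(\<integral>\<^sup>+t. (\<integral>\<^sup>+s. ?q s * far_kernel \<rho> t s \<partial>?M) \<partial>?M) \<le> Q * L2_norm_sq \<Gamma> w"
  proof -
    have "(\<integral>\<^sup>+t. (\<integral>\<^sup>+s. ?q s * far_kernel \<rho> t s \<partial>?M) \<partial>?M) = (\<integral>\<^sup>+s. (\<integral>\<^sup>+t. ?q s * far_kernel \<rho> t s \<partial>?M) \<partial>?M)"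
      by (rule Fubini') measurable
    also have "\<dots> \<le> Q * L2_norm_sq \<Gamma> w" using one by (simp add: far_kernel_commute[of \<rho> _ s for s] cong: nn_integral_cong)
    finally show ?thesis .
  qed
  have "Hhalf_seminorm_sq \<Gamma> w \<le> (\<integral>\<^sup>+t. (\<integral>\<^sup>+s. (\<Sum>y\<in>N. ?n y t s) +
      (2 * (?q t * far_kernel \<rho> t s) + 2 * (?q s * far_kernel \<rho> t s)) \<partial>?M) \<partial>?M)"
    unfolding Hhalf_seminorm_sq_eq using pt by (intro nn_integral_mono) auto
  also have "\<dots> = (\<integral>\<^sup>+t. (\<Sum>y\<in>N. (\<integral>\<^sup>+s. ?n y t s \<partial>?M)) + (2 * (\<integral>\<^sup>+s. ?q t * far_kernel \<rho> t s \<partial>?M)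
        + 2 * (\<integral>\<^sup>+s. ?q s * far_kernel \<rho> t s \<partial>?M)) \<partial>?M)"
    by (intro nn_integral_cong) (simp add: nn_integral_add nn_integral_cmult nn_integral_sum)
  also have "\<dots> = (\<Sum>y\<in>N. (\<integral>\<^sup>+t. (\<integral>\<^sup>+s. ?n y t s \<partial>?M) \<partial>?M)) + (2 * (\<integral>\<^sup>+t. (\<integral>\<^sup>+s. ?q t * far_kernel \<rho> t s \<partial>?M) \<partial>?M)
        + 2 * (\<integral>\<^sup>+t. (\<integral>\<^sup>+s. ?q s * far_kernel \<rho> t s \<partial>?M) \<partial>?M))"
    by (simp add: nn_integral_add nn_integral_cmult nn_integral_sum)
  also have "(\<Sum>y\<in>N. (\<integral>\<^sup>+t. (\<integral>\<^sup>+s. ?n y t s \<partial>?M) \<partial>?M)) = (\<Sum>y\<in>N. Hhalf_seminorm_sq (\<tau> y) w)"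
  proof (intro sum.cong refl)
    fix y assume y: "y \<in> N"
    then have [measurable]: "\<tau> y \<in> sets ?M" by (rule \<tau>M)
    show "(\<integral>\<^sup>+t. (\<integral>\<^sup>+s. ?n y t s \<partial>?M) \<partial>?M) = Hhalf_seminorm_sq (\<tau> y) w"
      unfolding Hhalf_seminorm_sq_subset[OF N(2)[OF y] assms(1) N(3)[OF y]]
      by (intro nn_integral_cong nn_integral_multc) measurable
  qed
  also have "2 * (\<integral>\<^sup>+t. (\<integral>\<^sup>+s. ?q t * far_kernel \<rho> t s \<partial>?M) \<partial>?M)
        + 2 * (\<integral>\<^sup>+t. (\<integral>\<^sup>+s. ?q s * far_kernel \<rho> t s \<partial>?M) \<partial>?M) \<le> 2 * (Q * L2_norm_sq \<Gamma> w) + 2 * (Q * L2_norm_sq \<Gamma> w)"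
    using one two by (intro add_mono mult_left_mono) auto
  also have "2 * (Q * L2_norm_sq \<Gamma> w) + 2 * (Q * L2_norm_sq \<Gamma> w) = 4 * Q * L2_norm_sq \<Gamma> w"
    by (simp add: mult.assoc distrib_right[symmetric])
  finally show ?thesis by (simp add: add_left_mono)
qed

lemma L2_norm_sq_le_cover:
  assumes "\<Gamma> \<in> sets borel" and [measurable]: "w \<in> borel_measurable (surface_measure \<Gamma>)"
    and N: "finite N" "\<And>y. y \<in> N \<Longrightarrow> \<tau> y \<in> sets borel" "\<And>y. y \<in> N \<Longrightarrow> \<tau> y \<subseteq> \<Gamma>" "\<Gamma> \<subseteq> (\<Union>y\<in>N. \<tau> y)"
  shows "L2_norm_sq \<Gamma> w \<le> (\<Sum>y\<in>N. L2_norm_sq (\<tau> y) w)"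
proof -
  let ?M = "surface_measure \<Gamma>"
  have \<tau>M [measurable]: "\<tau> y \<in> sets ?M" if "y \<in> N" for y
    using sets_surface_measureI[OF N(2)[OF that], of \<Gamma>] N(3)[OF that] by (simp add: Int_absorb2)
  have "L2_norm_sq \<Gamma> w \<le> (\<integral>\<^sup>+t. (\<Sum>y\<in>N. ennreal ((w t)\<^sup>2) * indicator (\<tau> y) t) \<partial>?M)"
    unfolding L2_norm_sq_def
  proof (rule nn_integral_mono)
    fix t assume "t \<in> space ?M"
    then obtain y where y: "y \<in> N" "t \<in> \<tau> y" using N(4) by auto
    have "ennreal ((w t)\<^sup>2) = ennreal ((w t)\<^sup>2) * indicator (\<tau> y) t" using y by simp
    also have "\<dots> \<le> (\<Sum>y\<in>N. ennreal ((w t)\<^sup>2) * indicator (\<tau> y) t)" using y N(1) by (intro member_le_sum) auto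
    finally show "ennreal ((w t)\<^sup>2) \<le> (\<Sum>y\<in>N. ennreal ((w t)\<^sup>2) * indicator (\<tau> y) t)" .
  qed
  also have "\<dots> = (\<Sum>y\<in>N. L2_norm_sq (\<tau> y) w)"
    by (simp add: nn_integral_sum L2_norm_sq_subset[OF N(2) assms(1) N(3)])
  finally show ?thesis .
qed

text \<open>Enlarging the inner integral from a patch to \<Gamma> leaves a single indicator in
  \<open>t\<close>; summed over \<open>N\<close>, it counts the patches that contain
  \<open>t\<close>.\<close>

lemma sum_seminorm_le:
  fixes \<Gamma> :: "'a::euclidean_space set"
  assumes "\<Gamma> \<in> sets borel" and sf: "sigma_finite_measure (surface_measure \<Gamma>)"
    and [measurable]: "w \<in> borel_measurable (surface_measure \<Gamma>)"
    and N: "finite N" "\<And>y. y \<in> N \<Longrightarrow> \<tau> y \<in> sets borel" "\<And>y. y \<in> N \<Longrightarrow> \<tau> y \<subseteq> \<Gamma>"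
    and mult: "AE t in surface_measure \<Gamma>. card {y\<in>N. t \<in> \<tau> y} \<le> k"
  shows "(\<Sum>y\<in>N. Hhalf_seminorm_sq (\<tau> y) w) \<le> of_nat k * Hhalf_seminorm_sq \<Gamma> w"
proof -
  let ?M = "surface_measure \<Gamma>"
  interpret sigma_finite_measure ?M by fact
  have \<tau>M [measurable]: "\<tau> y \<in> sets ?M" if "y \<in> N" for y
    using sets_surface_measureI[OF N(2)[OF that], of \<Gamma>] N(3)[OF that] by (simp add: Int_absorb2)
  let ?I = "\<lambda>t. \<integral>\<^sup>+s. slobodeckij w t s \<partial>?M"
  have "Hhalf_seminorm_sq (\<tau> y) w \<le> (\<integral>\<^sup>+t. ?I t * indicator (\<tau> y) t \<partial>?M)" if "y \<in> N" for y
    unfolding Hhalf_seminorm_sq_subset[OF N(2)[OF that] assms(1) N(3)[OF that]]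
    by (intro nn_integral_mono mult_right_mono) (auto simp: indicator_def)
  then have "(\<Sum>y\<in>N. Hhalf_seminorm_sq (\<tau> y) w) \<le> (\<Sum>y\<in>N. (\<integral>\<^sup>+t. ?I t * indicator (\<tau> y) t \<partial>?M))"
    by (rule sum_mono)
  also have "\<dots> = (\<integral>\<^sup>+t. (\<Sum>y\<in>N. ?I t * indicator (\<tau> y) t) \<partial>?M)"
    by (rule nn_integral_sum[symmetric]) measurable
  also have "\<dots> \<le> (\<integral>\<^sup>+t. of_nat k * ?I t \<partial>?M)"
  proof (rule nn_integral_mono_AE)
    show "AE t in ?M. (\<Sum>y\<in>N. ?I t * indicator (\<tau> y) t) \<le> of_nat k * ?I t"
      using mult
    proof eventually_elim
      case (elim t)
      have "(\<Sum>y\<in>N. ?I t * indicator (\<tau> y) t) = ?I t * (\<Sum>y\<in>N. indicator (\<tau> y) t)"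
        by (simp add: sum_distrib_left)
      also have "(\<Sum>y\<in>N. indicator (\<tau> y) t) = (of_nat (card {y\<in>N. t \<in> \<tau> y}) :: ennreal)"
        using N(1) by (simp add: indicator_def sum.If_cases Int_def)
      also have "?I t * \<dots> \<le> ?I t * of_nat k" using elim by (intro mult_left_mono) auto
      finally show ?case by (simp add: mult.commute)
    qed
  qed
  also have "\<dots> = of_nat k * Hhalf_seminorm_sq \<Gamma> w"
    unfolding Hhalf_seminorm_sq_eq by (rule nn_integral_cmult) measurable
  finally show ?thesis .
qed

section \<open>Norm equivalence on a mesh\<close>

context boundary_mesh
begin

section \<open>Patches: measurability, covering and bounded overlap\<close>

lemma finite_mesh: "finite \<T>"
  using mesh by (simp add: surface_mesh_def)

lemma cover: "(\<Union>E\<in>\<T>. elem_body E) = \<Gamma>"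
  using mesh by (simp add: surface_mesh_def)

lemma closed_body: "E \<in> \<T> \<Longrightarrow> closed (elem_body E)"
  by (intro compact_imp_closed compact_body)

lemma Gamma_borel: "\<Gamma> \<in> sets borel"
  by (simp add: Gamma_eq)

lemma bounded_Gamma: "bounded \<Gamma>"
  unfolding Gamma_eq by (intro compact_imp_bounded compact_frontier_bounded bounded_domain)

lemma finite_nodes: "finite (mesh_nodes \<T>)"
  unfolding mesh_nodes_def elem_vertices_def
  using finite_mesh simplex(1) by (intro finite_UN_I finite_imageI) (metis prod.collapse)+

lemma patch_subset: "patch \<T> y \<subseteq> \<Gamma>"
  using body_subset by (auto simp: patch_def)

lemma patch_borel: "patch \<T> y \<in> sets borel"
  unfolding patch_def using finite_mesh by (intro borel_closed closed_UN ballI closed_body) auto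

lemma dist_patch:
  assumes "y \<in> mesh_nodes \<T>" "t \<in> patch \<T> y" "s \<in> patch \<T> y"
  shows "dist t s \<le> 2 * \<kappa> * h"
proof -
  have "dist y x \<le> \<kappa> * h" if "x \<in> patch \<T> y" for x
    using that dist_body vertex_subset_body unfolding patch_eq[OF assms(1)] by fastforce
  from this[OF assms(2)] this[OF assms(3)] show ?thesis using dist_triangle3[of t s y] by simp
qed

lemma vertex_patch:
  assumes "E \<in> \<T>" "y \<in> elem_vertices E"
  shows "elem_body E \<subseteq> patch \<T> y"
  using assms unfolding patch_eq[OF vertex_is_node[OF assms]] by auto

lemma close_points_in_patch:
  assumes "t \<in> \<Gamma>" "s \<in> \<Gamma>" "dist t s < separation_const K \<sigma> \<kappa> * h"
  shows "\<exists>y\<in>mesh_nodes \<T>. t \<in> patch \<T> y \<and> s \<in> patch \<T> y"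
proof -
  obtain E F where EF: "E \<in> \<T>" "t \<in> elem_body E" "F \<in> \<T>" "s \<in> elem_body F"
    using assms cover by blast
  have "elem_body E \<inter> elem_body F \<noteq> {}"
    using disjoint_elements_separation[OF EF(1,3) _ EF(2,4)] assms(3) by force
  then obtain y where "y \<in> elem_vertices E" "y \<in> elem_vertices F" using common_vertex EF by blast
  then show ?thesis using EF vertex_is_node vertex_patch by blast
qed

lemma nodes_cover: "\<Gamma> \<subseteq> (\<Union>y\<in>mesh_nodes \<T>. patch \<T> y)"
proof
  fix t assume t: "t \<in> \<Gamma>"
  have "dist t t < separation_const K \<sigma> \<kappa> * h" using separation_const_pos[OF pos(1,2) K_pos] pos by simp
  then show "t \<in> (\<Union>y\<in>mesh_nodes \<T>. patch \<T> y)" using close_points_in_patch[OF t t] by blast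
qed

text \<open>A proper face has fewer than \<open>DIM('a)\<close> vertices, so up to translation its
  flat version lies in a subspace of dimension below \<open>DIM('a) - 1\<close>, and the chart is
  Lipschitz on it.\<close>

lemma intersection_null:
  assumes "E \<in> \<T>" "F \<in> \<T>" "E \<noteq> F"
  shows "emeasure (surface_measure \<Gamma>) (elem_body E \<inter> elem_body F) = 0"
proof -
  obtain V \<gamma> where E: "E = (V, \<gamma>)" by force
  have E': "(V, \<gamma>) \<in> \<T>" using assms E by simp
  obtain W X where "W \<subset> fst E" "X \<subset> fst F" "snd E ` W = snd F ` X"
      "elem_body E \<inter> elem_body F = snd E ` (convex hull W)"
    by (rule conforming[OF assms])
  then have W: "W \<subset> V" "elem_body E \<inter> elem_body F = \<gamma> ` (convex hull W)" using E by simp_all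
  have sub: "elem_body E \<inter> elem_body F \<subseteq> \<Gamma>" using body_subset[OF assms(1)] by auto
  show ?thesis
  proof (cases "W = {}")
    case False
    then obtain a where a: "a \<in> W" by auto
    have finW: "finite W" using W(1) simplex(1)[OF E'] by (metis finite_subset psubset_imp_subset)
    have "card W < DIM('a)" using psubset_card_mono[OF simplex(1)[OF E'] W(1)] simplex(2)[OF E'] by simp
    define U where "U = span ((\<lambda>x. x - a) ` (W - {a}))"
    have "dim U \<le> card ((\<lambda>x. x - a) ` (W - {a}))" unfolding U_def using finW by (simp add: dim_le_card')
    also have "\<dots> \<le> card (W - {a})" using finW by (intro card_image_le) auto
    also have "\<dots> = card W - 1" using a finW by simp
    also have "\<dots> < DIM('a) - 1" using \<open>card W < DIM('a)\<close> a finW card_gt_0_iff[of W] by auto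
    finally have dimU: "dim U < DIM('a) - 1" .
    have hull: "convex hull W \<subseteq> convex hull V" using W(1) by (intro hull_mono) auto
    have "hausdorff_outer (DIM('a) - 1) (\<gamma> ` (convex hull W)) = 0"
    proof (rule hausdorff_outer_lipschitz_image_eq_0[OF _ refl, of U])
      show "subspace U" by (simp add: U_def)
      show "x - y \<in> U" if xy: "x \<in> convex hull W" "y \<in> convex hull W" for x y
      proof -
        have "\<exists>u\<in>U. z = a + u" if "z \<in> convex hull W" for z
        proof -
          have "z \<in> affine hull W" using that convex_hull_subset_affine_hull by blast
          then have "z \<in> (\<lambda>x. a + x) ` U" using affine_hull_span2[OF a] by (simp add: U_def)
          then show ?thesis by auto
        qed
        from this[OF xy(1)] this[OF xy(2)] obtain u v where "u \<in> U" "v \<in> U" "x = a + u" "y = a + v" by blast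
        then show ?thesis using span_diff[of u _ v] by (simp add: U_def)
      qed
      have "bounded (convex hull W)" using finW by (simp add: bounded_convex_hull finite_imp_bounded)
      \<comment> \<open>A face consisting of one vertex has diameter 0, while the covering lemma
        asks for a positive bound.\<close>
      then show "dist x y \<le> diameter (convex hull W) + 1" if "x \<in> convex hull W" "y \<in> convex hull W" for x y
        using diameter_bounded_bound[of "convex hull W" x y] that by simp
      show "0 < diameter (convex hull W) + 1" using diameter_ge_0[OF \<open>bounded (convex hull W)\<close>] by simp
      show "dist (\<gamma> x) (\<gamma> y) \<le> \<sigma> * dist x y" if "x \<in> convex hull W" "y \<in> convex hull W" for x y
        using chart_upper[OF E'] hull that by auto
    qed (use pos dimU in auto)
    then have "emeasure (hausdorff_measure (DIM('a) - 1)) (elem_body E \<inter> elem_body F) = 0"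
      using emeasure_hausdorff_le[of "DIM('a) - 1" "elem_body E \<inter> elem_body F"] W(2) by simp
    then show ?thesis using emeasure_surface_measure[OF Gamma_borel sub] by simp
  qed (simp add: W)
qed

text \<open>A point lying in a single element belongs to the patches of the vertices of that element only.\<close>

lemma AE_patch_multiplicity:
  "AE t in surface_measure \<Gamma>. card {y\<in>mesh_nodes \<T>. t \<in> patch \<T> y} \<le> DIM('a)"
proof -
  have null: "AE t in surface_measure \<Gamma>. t \<notin> elem_body E \<inter> elem_body F" if "E \<in> \<T>" "F \<in> \<T>" "E \<noteq> F" for E F
  proof (rule AE_not_in)
    have "elem_body E \<inter> elem_body F \<inter> \<Gamma> = elem_body E \<inter> elem_body F" using body_subset[OF that(1)] by auto
    moreover have "elem_body E \<inter> elem_body F \<inter> \<Gamma> \<in> sets (surface_measure \<Gamma>)"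
      by (intro sets_surface_measureI borel_closed closed_Int closed_body that)
    ultimately show "elem_body E \<inter> elem_body F \<in> null_sets (surface_measure \<Gamma>)"
      using intersection_null[OF that] by (intro null_setsI) auto
  qed
  have "AE t in surface_measure \<Gamma>. E \<noteq> F \<longrightarrow> t \<notin> elem_body E \<inter> elem_body F" if "E \<in> \<T>" "F \<in> \<T>" for E F
  proof (cases "E = F")
    case False
    from null[OF that False] show ?thesis by eventually_elim simp
  qed simp
  then have "AE t in surface_measure \<Gamma>. \<forall>E\<in>\<T>. \<forall>F\<in>\<T>. E \<noteq> F \<longrightarrow> t \<notin> elem_body E \<inter> elem_body F"
    by (intro AE_finite_allI finite_mesh)
  moreover have "AE t in surface_measure \<Gamma>. t \<in> \<Gamma>" by (rule AE_I2) simp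
  ultimately show ?thesis
  proof eventually_elim
    case (elim t)
    obtain E where E: "E \<in> \<T>" "t \<in> elem_body E" using elim(2) cover by blast
    have "{y\<in>mesh_nodes \<T>. t \<in> patch \<T> y} \<subseteq> elem_vertices E"
    proof
      fix y assume "y \<in> {y\<in>mesh_nodes \<T>. t \<in> patch \<T> y}"
      then obtain F where F: "F \<in> \<T>" "y \<in> elem_vertices F" "t \<in> elem_body F"
        using patch_eq[of y] by auto
      then have "F = E" using E elim(1) by blast
      then show "y \<in> elem_vertices E" using F by simp
    qed
    then have sub: "{y\<in>mesh_nodes \<T>. t \<in> patch \<T> y} \<subseteq> snd E ` fst E"
      by (simp only: elem_vertices_def)
    have "(fst E, snd E) \<in> \<T>" using E(1) by simp
    note s = simplex(1,2)[OF this]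
    have "card {y\<in>mesh_nodes \<T>. t \<in> patch \<T> y} \<le> card (snd E ` fst E)"
      by (rule card_mono[OF finite_imageI[OF s(1)] sub])
    also have "\<dots> \<le> card (fst E)" by (rule card_image_le[OF s(1)])
    finally show ?case using s(2) by simp
  qed
qed

text \<open>\<open>A\<close> has to be chosen from \<Omega> before the mesh is given, so it enters
  as an assumption instead of being obtained inside the locale.\<close>

context
  fixes A :: real
  assumes A_nonneg: "A \<ge> 0"
    and upper_regular: "\<And>x r. r > 0 \<Longrightarrow>
      emeasure (hausdorff_measure (DIM('a) - 1)) (\<Gamma> \<inter> ball x r) \<le> ennreal (A * r ^ (DIM('a) - 1))"
begin

lemma sigma_finite_surface: "sigma_finite_measure (surface_measure \<Gamma>)"
proof -
  obtain R where R: "\<Gamma> \<subseteq> ball 0 R" "R > 0"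
    using bounded_subset_ballD[OF bounded_Gamma, of 0] by auto
  have "emeasure (surface_measure \<Gamma>) \<Gamma> = emeasure (hausdorff_measure (DIM('a) - 1)) (\<Gamma> \<inter> ball 0 R)"
    using R(1) by (simp add: emeasure_surface_measure[OF Gamma_borel] Int_absorb2)
  also have "\<dots> < \<infinity>" using upper_regular[OF R(2), of 0] by (simp add: order_le_less_trans)
  finally have "finite_measure (surface_measure \<Gamma>)" by (intro finite_measureI) auto
  then show ?thesis by (simp add: finite_measure_def)
qed

lemma far_integral_le:
  assumes "\<rho> > 0"
  shows "(\<integral>\<^sup>+s. far_kernel \<rho> t s \<partial>surface_measure \<Gamma>) \<le> ennreal (2 ^ DIM('a) * A / \<rho>)"
proof (rule far_kernel_integral_le[where m = "DIM('a) - 1"])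
  show "emeasure (surface_measure \<Gamma>) (space (surface_measure \<Gamma>) \<inter> ball t r) \<le> ennreal (A * r ^ (DIM('a) - 1))"
    if "r > 0" for r
    using upper_regular[OF that, of t] by (simp add: emeasure_surface_measure[OF Gamma_borel])
qed (use assms A_nonneg in auto)

end

end

text \<open>The summands come from the L2 part, where the factor h is bounded by \<kappa> times the
  diameter \<open>D\<close> of \<Gamma>, from the near field, and from the far field, where h
  cancels.\<close>

definition lower_const :: "nat \<Rightarrow> real \<Rightarrow> real \<Rightarrow> real \<Rightarrow> real \<Rightarrow> real \<Rightarrow> real \<Rightarrow> real" where
  "lower_const n A K \<sigma> \<kappa> C0 D = C0\<^sup>2 * (2 * \<kappa>) ^ n * (\<kappa> * D) + 1
      + 4 * (2 ^ n * A / separation_const K \<sigma> \<kappa>) * (C0\<^sup>2 * (2 * \<kappa>) ^ n)"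

lemma Hhalf_norm_sq_empty: "Hhalf_norm_sq {} w = 0"
  by (simp add: Hhalf_norm_sq_def L2_norm_sq_def Hhalf_seminorm_sq_def nn_integral_empty)

text \<open>\<open>enn2real\<close> sends infinity to 0, so a bound on \<open>L2_norm\<close>
  carries information only together with finiteness.\<close>

lemma L2_norm_sq_le_of_L2_norm_le:
  assumes "L2_norm \<tau> \<phi> \<le> b" "L2_norm_sq \<tau> \<phi> < \<infinity>"
  shows "L2_norm_sq \<tau> \<phi> \<le> ennreal (b\<^sup>2)"
proof -
  have "enn2real (L2_norm_sq \<tau> \<phi>) = (L2_norm \<tau> \<phi>)\<^sup>2" by (simp add: L2_norm_def)
  also have "\<dots> \<le> b\<^sup>2" using assms(1) by (intro power_mono) (auto simp: L2_norm_def)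
  finally show ?thesis using assms(2) by (metis ennreal_enn2real ennreal_leI infinity_ennreal_def)
qed

context boundary_mesh
begin

text \<open>The general estimate with d = 2 \<kappa> h and q = C0^2 h^(1-n), whose product q d^n is
  linear in h.\<close>

lemma L2_le_seminorm_patch:
  assumes sf: "sigma_finite_measure (surface_measure \<Gamma>)"
    and \<phi>: "admissible_functionals \<Gamma> \<T> h c0 C0 \<phi>"
    and w: "w \<in> L2_space \<Gamma>" "(LINT s|surface_measure \<Gamma>. w s * \<phi> y s) = 0" and y: "y \<in> mesh_nodes \<T>"
  shows "L2_norm_sq (patch \<T> y) w
    \<le> ennreal (C0\<^sup>2 * (2 * \<kappa>) ^ DIM('a) * h) * Hhalf_seminorm_sq (patch \<T> y) w"
proof -
  let ?n = "DIM('a)"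
  let ?b = "C0 * h powr (1 / 2 - real ?n / 2)"
  have f: "\<phi> y \<in> L2_space \<Gamma>" "(LINT s|surface_measure \<Gamma>. \<phi> y s) = 1"
      "ess_support \<Gamma> (\<phi> y) \<subseteq> patch \<T> y" "L2_norm (patch \<T> y) (\<phi> y) \<le> ?b"
    using \<phi> y unfolding admissible_functionals_def by auto
  have "L2_norm_sq (patch \<T> y) (\<phi> y) \<le> L2_norm_sq \<Gamma> (\<phi> y)"
    unfolding L2_norm_sq_subset[OF patch_borel Gamma_borel patch_subset] unfolding L2_norm_sq_def
    by (intro nn_integral_mono) (auto simp: indicator_def)
  also have "\<dots> < \<infinity>" using f(1) by (simp add: L2_space_def)
  finally have q: "L2_norm_sq (patch \<T> y) (\<phi> y) \<le> ennreal (?b\<^sup>2)"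
    by (rule L2_norm_sq_le_of_L2_norm_le[OF f(4)])
  have "(h powr (1 / 2 - real ?n / 2))\<^sup>2 = h powr (1 - real ?n)"
    by (simp add: power2_eq_square powr_add[symmetric])
  also have "\<dots> = h / h ^ ?n" using pos by (simp add: powr_diff powr_realpow)
  finally have "?b\<^sup>2 * (2 * \<kappa> * h) ^ ?n = C0\<^sup>2 * (2 * \<kappa>) ^ ?n * h"
    using pos by (simp add: power_mult_distrib)
  then show ?thesis
    using L2_le_seminorm[OF patch_borel Gamma_borel patch_subset sf dist_patch[OF y] f(1-3) q _ _ w] pos by simp
qed

proposition norm_le_sum_seminorms:
  assumes A: "A \<ge> 0" "\<And>x r. r > 0 \<Longrightarrow>
      emeasure (hausdorff_measure (DIM('a) - 1)) (\<Gamma> \<inter> ball x r) \<le> ennreal (A * r ^ (DIM('a) - 1))"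
    and \<phi>: "admissible_functionals \<Gamma> \<T> h c0 C0 \<phi>"
    and w: "w \<in> L2_space \<Gamma>" "\<And>y. y \<in> mesh_nodes \<T> \<Longrightarrow> (LINT s|surface_measure \<Gamma>. w s * \<phi> y s) = 0"
  shows "Hhalf_norm_sq \<Gamma> w \<le> ennreal (lower_const DIM('a) A K \<sigma> \<kappa> C0 (diameter \<Gamma>)) *
    (\<Sum>y\<in>mesh_nodes \<T>. Hhalf_seminorm_sq (patch \<T> y) w)"
proof (cases "\<T> = {}")
  case True
  then have "\<Gamma> = {}" using cover by auto
  then show ?thesis by (simp add: Hhalf_norm_sq_empty)
next
  case False
  let ?S = "\<Sum>y\<in>mesh_nodes \<T>. Hhalf_seminorm_sq (patch \<T> y) w"
  let ?q = "C0\<^sup>2 * (2 * \<kappa>) ^ DIM('a)"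
  let ?\<delta> = "separation_const K \<sigma> \<kappa>"
  let ?a = "2 ^ DIM('a) * A / ?\<delta>"
  note sf = sigma_finite_surface[OF A]
  have \<delta>: "?\<delta> > 0" using pos K_pos by (intro separation_const_pos)
  have nn: "?q \<ge> 0" "?a \<ge> 0" using \<delta> A(1) pos by simp_all
  have wm: "w \<in> borel_measurable (surface_measure \<Gamma>)" using w(1) by (simp add: L2_space_def)
  \<comment> \<open>Any single element bounds \<open>h\<close> by the diameter of \<Gamma>, which
    removes the mesh size from the L2 part.\<close>
  obtain E where E: "E \<in> \<T>" using False by auto
  have "h \<le> \<kappa> * diameter (elem_body E)" using quasi_uniform E by (auto simp: quasi_uniform_def)
  also have "\<dots> \<le> \<kappa> * diameter \<Gamma>"
    using diameter_subset[OF body_subset[OF E] bounded_Gamma] pos by (intro mult_left_mono) auto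
  finally have hD: "h \<le> \<kappa> * diameter \<Gamma>" .
  have "L2_norm_sq \<Gamma> w \<le> (\<Sum>y\<in>mesh_nodes \<T>. L2_norm_sq (patch \<T> y) w)"
    by (intro L2_norm_sq_le_cover Gamma_borel wm finite_nodes patch_borel patch_subset nodes_cover)
  also have "\<dots> \<le> (\<Sum>y\<in>mesh_nodes \<T>. ennreal (?q * h) * Hhalf_seminorm_sq (patch \<T> y) w)"
    by (intro sum_mono L2_le_seminorm_patch[OF sf \<phi> w(1)] w(2))
  also have "\<dots> = ennreal (?q * h) * ?S" by (simp add: sum_distrib_left)
  finally have L2: "L2_norm_sq \<Gamma> w \<le> ennreal (?q * h) * ?S" .
  have "Hhalf_seminorm_sq \<Gamma> w \<le> ?S + 4 * ennreal (2 ^ DIM('a) * A / (?\<delta> * h)) * L2_norm_sq \<Gamma> w"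
    using \<delta> pos
    by (intro seminorm_le_near_plus_far[OF Gamma_borel sf wm finite_nodes patch_borel patch_subset, of "?\<delta> * h"]
      close_points_in_patch far_integral_le[OF A] mult_pos_pos)
  also have "\<dots> \<le> ?S + 4 * ennreal (2 ^ DIM('a) * A / (?\<delta> * h)) * (ennreal (?q * h) * ?S)"
    using L2 by (intro add_left_mono mult_left_mono) auto
  also have "4 * ennreal (2 ^ DIM('a) * A / (?\<delta> * h)) * (ennreal (?q * h) * ?S) = ennreal (4 * ?a * ?q) * ?S"
  proof -
    have x1: "0 \<le> 2 ^ DIM('a) * A / (?\<delta> * h)" using \<delta> A(1) pos by simp
    have x2: "0 \<le> ?q * h" by (intro mult_nonneg_nonneg nn) (use pos in simp)
    have "4 * ?a * ?q = 4 * (2 ^ DIM('a) * A / (?\<delta> * h)) * (?q * h)" using pos by simp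
    also have "ennreal \<dots> = ennreal 4 * ennreal (2 ^ DIM('a) * A / (?\<delta> * h)) * ennreal (?q * h)"
      unfolding ennreal_mult[OF mult_nonneg_nonneg[OF zero_le_numeral x1] x2] ennreal_mult[OF zero_le_numeral x1] ..
    finally show ?thesis by (simp add: mult.assoc)
  qed
  finally have semi: "Hhalf_seminorm_sq \<Gamma> w \<le> ?S + ennreal (4 * ?a * ?q) * ?S" .
  have e1: "0 \<le> ?q * (\<kappa> * diameter \<Gamma>)" by (intro mult_nonneg_nonneg[OF nn(1)] order_trans[OF _ hD]) (use pos in simp)
  have e2: "0 \<le> 4 * ?a * ?q" by (intro mult_nonneg_nonneg nn) simp
  have "L2_norm_sq \<Gamma> w \<le> ennreal (?q * (\<kappa> * diameter \<Gamma>)) * ?S"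
    using L2 by (rule order_trans) (intro mult_right_mono ennreal_leI mult_left_mono hD nn(1) zero_le)
  then have "Hhalf_norm_sq \<Gamma> w \<le> ennreal (?q * (\<kappa> * diameter \<Gamma>)) * ?S + (ennreal 1 * ?S + ennreal (4 * ?a * ?q) * ?S)"
    unfolding Hhalf_norm_sq_def using semi by (intro add_mono) auto
  also have "\<dots> = (ennreal (?q * (\<kappa> * diameter \<Gamma>)) + (ennreal 1 + ennreal (4 * ?a * ?q))) * ?S"
    by (simp only: distrib_right)
  also have "ennreal (?q * (\<kappa> * diameter \<Gamma>)) + (ennreal 1 + ennreal (4 * ?a * ?q))
      = ennreal (?q * (\<kappa> * diameter \<Gamma>) + (1 + 4 * ?a * ?q))"
    unfolding ennreal_plus[OF e1 add_nonneg_nonneg[OF zero_le_one e2]] ennreal_plus[OF zero_le_one e2] ..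
  also have "?q * (\<kappa> * diameter \<Gamma>) + (1 + 4 * ?a * ?q) = lower_const DIM('a) A K \<sigma> \<kappa> C0 (diameter \<Gamma>)"
    by (simp add: lower_const_def)
  finally show ?thesis .
qed

end

lemma lower_const_pos:
  "A \<ge> 0 \<Longrightarrow> K > 0 \<Longrightarrow> \<sigma> > 0 \<Longrightarrow> \<kappa> > 0 \<Longrightarrow> D \<ge> 0 \<Longrightarrow> lower_const n A K \<sigma> \<kappa> C0 D > 0"
proof -
  assume *: "A \<ge> 0" "K > 0" "\<sigma> > 0" "\<kappa> > 0" "D \<ge> 0"
  have "0 \<le> C0\<^sup>2 * (2 * \<kappa>) ^ n * (\<kappa> * D)"
    and "0 \<le> 4 * (2 ^ n * A / separation_const K \<sigma> \<kappa>) * (C0\<^sup>2 * (2 * \<kappa>) ^ n)"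
    using * separation_const_pos[of \<sigma> \<kappa> K] by simp_all
  then show ?thesis unfolding lower_const_def by linarith
qed

theorem corollary3p4:
  fixes \<Omega> \<Gamma> :: "(real ^ 'n) set" and \<sigma> \<kappa> c0 C0 B :: real
  assumes "CARD('n) = 2 \<or> CARD('n) = 3"
    and "admissible_domain \<Omega>" and "\<Gamma> = frontier \<Omega>"
    and "0 < \<sigma>" and "0 < \<kappa>" and "0 < c0" and "0 < C0" and "0 \<le> B"
  shows "\<exists>c>0. \<exists>C>0.
    \<forall>(h :: real) (\<T> :: (real ^ 'n) element set)
      (Pr :: ((real ^ 'n) \<Rightarrow> real) \<Rightarrow> ((real ^ 'n) \<Rightarrow> real))
      (\<phi> :: (real ^ 'n) \<Rightarrow> (real ^ 'n) \<Rightarrow> real).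
      0 < h \<and> surface_mesh \<Gamma> \<T> \<and>
      quasi_uniform \<kappa> h \<T> \<and> shape_regular \<Gamma> \<sigma> \<T> \<and>
      bounded_projector \<Gamma> B Pr \<and>
      admissible_functionals \<Gamma> \<T> h c0 C0 \<phi> \<and>
      (\<forall>y\<in>mesh_nodes \<T>. \<forall>v\<in>Hhalf_space \<Gamma>.
         (LINT s|surface_measure \<Gamma>. (v s - Pr v s) * \<phi> y s) = 0) \<longrightarrow>
      (\<forall>v\<in>Hhalf_space \<Gamma>.
         ennreal c * Hhalf_norm_sq \<Gamma> v
           \<le> Hhalf_norm_sq \<Gamma> (Pr v)
              + (\<Sum>y\<in>mesh_nodes \<T>. Hhalf_seminorm_sq (patch \<T> y) (\<lambda>s. v s - Pr v s)) \<and>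
         Hhalf_norm_sq \<Gamma> (Pr v)
              + (\<Sum>y\<in>mesh_nodes \<T>. Hhalf_seminorm_sq (patch \<T> y) (\<lambda>s. v s - Pr v s))
           \<le> ennreal C * Hhalf_norm_sq \<Gamma> v)"
proof -
  let ?n = "DIM(real ^ 'n)"
  have dom: "open \<Omega>" "bounded \<Omega>" "lipschitz_boundary \<Omega>" "geodesic_dist_bounded \<Gamma>"
    using assms(2,3) by (auto simp: admissible_domain_def)
  obtain K where K: "K > 0" "\<And>x y. x \<in> \<Gamma> \<Longrightarrow> y \<in> \<Gamma> \<Longrightarrow> geodesic_dist \<Gamma> x y \<le> ennreal (K * dist x y)"
    using dom(4) unfolding geodesic_dist_bounded_def by blast
  obtain A where A: "A > 0" "\<And>x r. r > 0 \<Longrightarrow>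
      emeasure (hausdorff_measure (?n - 1)) (\<Gamma> \<inter> ball x r) \<le> ennreal (A * r ^ (?n - 1))"
    using lipschitz_boundary_upper_regular[OF dom(1-3)] assms(3) by auto
  have "bounded \<Gamma>" unfolding assms(3) by (intro compact_imp_bounded compact_frontier_bounded dom(2))
  define C1 where "C1 = lower_const ?n A K \<sigma> \<kappa> C0 (diameter \<Gamma>)"
  have C1: "C1 > 0" unfolding C1_def
    using A(1) K(1) assms(4,5) diameter_ge_0[OF \<open>bounded \<Gamma>\<close>] by (intro lower_const_pos) auto
  \<comment> \<open>Splitting v into its projection and w costs a factor 2 on each square, and C1
    bounds the norm of w by the sum over the patches.\<close>
  define c where "c = 1 / (2 + 2 * C1)"
  \<comment> \<open>The first term bounds the projection. In the second, \<open>?n\<close> is the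
    overlap of the patches and 2 + 2 B^2 bounds the squared norm of w.\<close>
  define C where "C = B\<^sup>2 + real ?n * (2 + 2 * B\<^sup>2)"
  have "c > 0" using C1 by (simp add: c_def)
  have "2 + 2 * B\<^sup>2 > 0" by (intro add_pos_nonneg) auto
  then have "C > 0" unfolding C_def by (rule add_nonneg_pos[OF zero_le_power2 mult_pos_pos[rotated]]) simp
  have main: "ennreal c * Hhalf_norm_sq \<Gamma> v
      \<le> Hhalf_norm_sq \<Gamma> (Pr v) + (\<Sum>y\<in>mesh_nodes \<T>. Hhalf_seminorm_sq (patch \<T> y) (\<lambda>s. v s - Pr v s)) \<and>
      Hhalf_norm_sq \<Gamma> (Pr v) + (\<Sum>y\<in>mesh_nodes \<T>. Hhalf_seminorm_sq (patch \<T> y) (\<lambda>s. v s - Pr v s))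
      \<le> ennreal C * Hhalf_norm_sq \<Gamma> v"
    if h: "0 < h" "surface_mesh \<Gamma> \<T>" "quasi_uniform \<kappa> h \<T>" "shape_regular \<Gamma> \<sigma> \<T>"
      and Pr: "bounded_projector \<Gamma> B Pr" and \<phi>: "admissible_functionals \<Gamma> \<T> h c0 C0 \<phi>"
      and orth: "\<forall>y\<in>mesh_nodes \<T>. \<forall>v\<in>Hhalf_space \<Gamma>. (LINT s|surface_measure \<Gamma>. (v s - Pr v s) * \<phi> y s) = 0"
      and v: "v \<in> Hhalf_space \<Gamma>"
    for h :: real and \<T> :: "(real ^ 'n) element set" and Pr \<phi> and v :: "real ^ 'n \<Rightarrow> real"
  proof
    interpret boundary_mesh \<Omega> \<Gamma> K \<sigma> \<kappa> h \<T>
      by unfold_locales (use dom assms K h in auto)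
    let ?u = "Pr v" and ?w = "\<lambda>s. v s - Pr v s"
    let ?S = "\<Sum>y\<in>mesh_nodes \<T>. Hhalf_seminorm_sq (patch \<T> y) ?w"
    have "A \<ge> 0" using A(1) by simp
    note sf = sigma_finite_surface[OF \<open>A \<ge> 0\<close> A(2)]
    have u: "?u \<in> Hhalf_space \<Gamma>" "Hhalf_norm_sq \<Gamma> ?u \<le> ennreal (B\<^sup>2) * Hhalf_norm_sq \<Gamma> v"
      using Pr v by (auto simp: bounded_projector_def)
    have meas [measurable]: "v \<in> borel_measurable (surface_measure \<Gamma>)" "?u \<in> borel_measurable (surface_measure \<Gamma>)"
      using u v by (auto simp: Hhalf_space_def L2_space_def)
    have wmeas: "?w \<in> borel_measurable (surface_measure \<Gamma>)" by measurable
    have w_norm: "Hhalf_norm_sq \<Gamma> ?w \<le> 2 * Hhalf_norm_sq \<Gamma> v + 2 * Hhalf_norm_sq \<Gamma> ?u"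
      using Hhalf_norm_sq_add_le[OF sf meas(1), of "\<lambda>s. - ?u s"] by (simp add: Hhalf_norm_sq_minus)
    have "L2_norm_sq \<Gamma> ?w \<le> Hhalf_norm_sq \<Gamma> ?w" by (simp add: Hhalf_norm_sq_def)
    also have "\<dots> < \<infinity>"
      using u(1) v by (intro order_le_less_trans[OF w_norm]) (auto simp: Hhalf_space_def ennreal_mult_less_top)
    finally have wL2: "?w \<in> L2_space \<Gamma>" using wmeas by (simp add: L2_space_def)
    have w_le: "Hhalf_norm_sq \<Gamma> ?w \<le> ennreal C1 * ?S"
      unfolding C1_def using \<open>A \<ge> 0\<close> A(2) \<phi> wL2 orth v by (intro norm_le_sum_seminorms) auto
    show "ennreal c * Hhalf_norm_sq \<Gamma> v \<le> Hhalf_norm_sq \<Gamma> ?u + ?S"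
    proof -
      have "Hhalf_norm_sq \<Gamma> v = Hhalf_norm_sq \<Gamma> (\<lambda>s. ?u s + ?w s)" by simp
      also have "\<dots> \<le> 2 * Hhalf_norm_sq \<Gamma> ?u + 2 * Hhalf_norm_sq \<Gamma> ?w"
        by (rule Hhalf_norm_sq_add_le[OF sf meas(2) wmeas])
      also have "\<dots> \<le> ennreal 2 * Hhalf_norm_sq \<Gamma> ?u + ennreal 2 * (ennreal C1 * ?S)"
        using w_le by (intro add_mono mult_mono) auto
      also have "\<dots> = ennreal 2 * Hhalf_norm_sq \<Gamma> ?u + ennreal (2 * C1) * ?S"
        using C1 by (simp only: ennreal_mult[of 2 C1] mult.assoc)
      also have "\<dots> \<le> ennreal (2 + 2 * C1) * Hhalf_norm_sq \<Gamma> ?u + ennreal (2 + 2 * C1) * ?S"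
        using C1 by (intro add_mono mult_right_mono ennreal_leI) auto
      finally have "Hhalf_norm_sq \<Gamma> v \<le> ennreal (2 + 2 * C1) * (Hhalf_norm_sq \<Gamma> ?u + ?S)"
        by (simp only: distrib_left)
      then have "ennreal c * Hhalf_norm_sq \<Gamma> v \<le> ennreal c * (ennreal (2 + 2 * C1) * (Hhalf_norm_sq \<Gamma> ?u + ?S))"
        by (rule mult_left_mono) simp
      also have "\<dots> = ennreal (c * (2 + 2 * C1)) * (Hhalf_norm_sq \<Gamma> ?u + ?S)"
        using C1 \<open>c > 0\<close> by (subst ennreal_mult) (auto simp: mult.assoc)
      also have "c * (2 + 2 * C1) = 1" using C1 by (simp add: c_def)
      finally show ?thesis by simp
    qed
    show "Hhalf_norm_sq \<Gamma> ?u + ?S \<le> ennreal C * Hhalf_norm_sq \<Gamma> v"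
    proof -
      have "?S \<le> of_nat ?n * Hhalf_seminorm_sq \<Gamma> ?w"
        by (intro sum_seminorm_le Gamma_borel sf wmeas finite_nodes patch_borel patch_subset AE_patch_multiplicity)
      also have "\<dots> \<le> of_nat ?n * Hhalf_norm_sq \<Gamma> ?w"
        by (intro mult_left_mono) (auto simp: Hhalf_norm_sq_def)
      also have "\<dots> \<le> of_nat ?n * (2 * Hhalf_norm_sq \<Gamma> v + 2 * Hhalf_norm_sq \<Gamma> ?u)"
        using w_norm by (intro mult_left_mono) auto
      also have "\<dots> \<le> of_nat ?n * (2 * Hhalf_norm_sq \<Gamma> v + 2 * (ennreal (B\<^sup>2) * Hhalf_norm_sq \<Gamma> v))"
        using u(2) by (intro mult_left_mono add_left_mono) auto
      also have "\<dots> = of_nat ?n * (2 + 2 * ennreal (B\<^sup>2)) * Hhalf_norm_sq \<Gamma> v"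
        by (simp only: distrib_right mult.assoc)
      also have "of_nat ?n * (2 + 2 * ennreal (B\<^sup>2)) = ennreal (real ?n * (2 + 2 * B\<^sup>2))"
        by (simp add: ennreal_mult ennreal_of_nat_eq_real_of_nat)
      finally have "Hhalf_norm_sq \<Gamma> ?u + ?S
          \<le> ennreal (B\<^sup>2) * Hhalf_norm_sq \<Gamma> v + ennreal (real ?n * (2 + 2 * B\<^sup>2)) * Hhalf_norm_sq \<Gamma> v"
        using u(2) by (intro add_mono)
      also have "\<dots> = ennreal C * Hhalf_norm_sq \<Gamma> v"
        unfolding C_def by (subst ennreal_plus) (auto simp: distrib_right)
      finally show ?thesis .
    qed
  qed
  show ?thesis
    by (rule exI[of _ c], rule conjI[OF \<open>c > 0\<close>], rule exI[of _ C], rule conjI[OF \<open>C > 0\<close>],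
        intro allI impI ballI, elim conjE, rule main; assumption)
qed

end
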